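(* Let $I=I(S)\subset k[\mathbf{P}^2]$, where $S$ is a set of $n$ generic points of $\mathbf{P}^2$. Then $I^2$ contains $I^{(3)}$ for every $n\ge 1$.
   Context: $k$ is an arbitrary algebraically closed field and $k[\mathbf{P}^2]$ is the polynomial ring in $3$ variables over $k$, the homogeneous coordinate ring of $\mathbf{P}^2$. For a finite set of points $S=\{p_1,\dots,p_n\}\subset\mathbf{P}^2$, $I(S)$ denotes the radical homogeneous ideal generated by all forms vanishing at every point of $S$. For $I=I(S)$, the symbolic power $I^{(m)}$ is $\bigcap_i I(p_i)^m$, i.e. the ideal generated by all forms vanishing to order at least $m$ at each $p_i$, while $I^r$ denotes the ordinary $r$-th power of $I$. *)

theory Defs
  imports
    "HOL-Library.Poly_Mapping"
    "HOL-Library.Numeral_Type"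
    "HOL-Library.FuncSet"
    "HOL-Computational_Algebra.Polynomial"
begin

section \<open>Multivariate polynomials\<close>

text \<open>Finitely supported maps from exponent vectors to coefficients, with the convolution
  product of \<^theory>\<open>HOL-Library.Poly_Mapping\<close>, form the polynomial ring in the
  variables \<open>'v\<close>. The homogeneous coordinate ring of the plane is \<open>(3, 'k) mpoly\<close>, where
  \<open>3\<close> is the type with three elements.\<close>

type_synonym ('v, 'k) mpoly = "('v \<Rightarrow>\<^sub>0 nat) \<Rightarrow>\<^sub>0 'k"

definition eval_mpoly :: "('v \<Rightarrow> 'k) \<Rightarrow> ('v, 'k::comm_ring_1) mpoly \<Rightarrow> 'k" where
  "eval_mpoly x F =
     (\<Sum>m\<in>Poly_Mapping.keys F. Poly_Mapping.lookup F m *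
        (\<Prod>v\<in>Poly_Mapping.keys m. x v ^ Poly_Mapping.lookup m v))"

text \<open>The zero polynomial is a form of every degree.\<close>

definition is_form :: "nat \<Rightarrow> ('v, 'k::zero) mpoly \<Rightarrow> bool" where
  "is_form d F \<longleftrightarrow>
     (\<forall>m\<in>Poly_Mapping.keys F. (\<Sum>v\<in>Poly_Mapping.keys m. Poly_Mapping.lookup m v) = d)"

section \<open>Ideals\<close>

text \<open>Ideals of a commutative ring are the submodules of the ring as a module over itself.\<close>

definition ideal_gen :: "'r::comm_ring_1 set \<Rightarrow> 'r set" where
  "ideal_gen B = module.span (*) B"

definition ideal_mult :: "'r::comm_ring_1 set \<Rightarrow> 'r set \<Rightarrow> 'r set" where
  "ideal_mult I J = ideal_gen {a * b | a b. a \<in> I \<and> b \<in> J}"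

primrec ideal_power :: "'r::comm_ring_1 set \<Rightarrow> nat \<Rightarrow> 'r set" where
  "ideal_power I 0 = UNIV"
| "ideal_power I (Suc r) = ideal_mult I (ideal_power I r)"

section \<open>The projective plane and ideals of points\<close>

text \<open>A point is the set of all its homogeneous coordinate vectors.\<close>

type_synonym 'k point = "(3 \<Rightarrow> 'k) set"

definition proportional :: "((3 \<Rightarrow> 'k::field) \<times> (3 \<Rightarrow> 'k)) set" where
  "proportional =
     {(v, w). v \<noteq> (\<lambda>_. 0) \<and> w \<noteq> (\<lambda>_. 0) \<and> (\<exists>c. c \<noteq> 0 \<and> w = (\<lambda>i. c * v i))}"

definition proj_plane :: "'k::field point set" where
  "proj_plane = {v. v \<noteq> (\<lambda>_. 0)} // proportional"

definition vanishes_at :: "(3, 'k::field) mpoly \<Rightarrow> 'k point \<Rightarrow> bool" where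
  "vanishes_at F p \<longleftrightarrow> (\<forall>v\<in>p. eval_mpoly v F = 0)"

definition ideal_of_points :: "'k::field point set \<Rightarrow> (3, 'k) mpoly set" where
  "ideal_of_points S = ideal_gen {F. (\<exists>d. is_form d F) \<and> (\<forall>p\<in>S. vanishes_at F p)}"

text \<open>The \<open>m\<close>-th symbolic power of \<open>ideal_of_points S\<close>.\<close>

definition symbolic_power :: "'k::field point set \<Rightarrow> nat \<Rightarrow> (3, 'k) mpoly set" where
  "symbolic_power S m = (\<Inter>p\<in>S. ideal_power (ideal_of_points {p}) m)"

section \<open>Generic sets of points\<close>

text \<open>The product of \<open>n\<close> planes carries the Zariski topology, whose closed sets are the common
  zero loci of multihomogeneous polynomials in \<open>n\<close> groups of three variables; the variable
  \<open>(i, j)\<close> is the \<open>j\<close>-th homogeneous coordinate of the \<open>i\<close>-th point.\<close>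

definition point_tuples :: "nat \<Rightarrow> (nat \<Rightarrow> 'k::field point) set" where
  "point_tuples n = {..<n} \<rightarrow>\<^sub>E proj_plane"

definition is_multiform :: "nat \<Rightarrow> (nat \<times> 3, 'k::zero) mpoly \<Rightarrow> bool" where
  "is_multiform n F \<longleftrightarrow>
     (\<exists>d. \<forall>m\<in>Poly_Mapping.keys F.
        Poly_Mapping.keys m \<subseteq> {..<n} \<times> UNIV \<and>
        (\<forall>i<n. (\<Sum>j\<in>UNIV. Poly_Mapping.lookup m (i, j)) = d i))"

definition multiform_vanishes_at ::
    "nat \<Rightarrow> (nat \<times> 3, 'k::field) mpoly \<Rightarrow> (nat \<Rightarrow> 'k point) \<Rightarrow> bool" where
  "multiform_vanishes_at n F p \<longleftrightarrow>
     (\<forall>x. (\<forall>i<n. x i \<in> p i) \<longrightarrow> eval_mpoly (\<lambda>(i, j). x i j) F = 0)"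

definition zariski_closed :: "nat \<Rightarrow> (nat \<Rightarrow> 'k::field point) set \<Rightarrow> bool" where
  "zariski_closed n Z \<longleftrightarrow>
     (\<exists>T. (\<forall>F\<in>T. is_multiform n F) \<and>
          Z = {p \<in> point_tuples n. \<forall>F\<in>T. multiform_vanishes_at n F p})"

definition zariski_open :: "nat \<Rightarrow> (nat \<Rightarrow> 'k::field point) set \<Rightarrow> bool" where
  "zariski_open n U \<longleftrightarrow> U \<subseteq> point_tuples n \<and> zariski_closed n (point_tuples n - U)"

text \<open>A property holds for a set of \<open>n\<close> generic points if there is a nonempty Zariski open set
  of \<open>n\<close>-tuples all of whose members consist of \<open>n\<close> distinct points and have the property.
  Over an algebraically closed field such as the closure of a finite field there are no tuples
  with coordinates algebraically independent over the prime field, so genericity is not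
  defined that way.\<close>

definition for_generic_points :: "nat \<Rightarrow> ('k::field point set \<Rightarrow> bool) \<Rightarrow> bool" where
  "for_generic_points n P \<longleftrightarrow>
     (\<exists>U. zariski_open n U \<and> U \<noteq> {} \<and>
          (\<forall>p\<in>U. inj_on p {..<n} \<and> P (p ` {..<n})))"

end

theory Submission
  imports Defs
begin

text \<open>
  Let \<open>t\<close> be minimal with \<open>n \<le> (t + 1) * (t + 2) / 2\<close>. If the points impose independent conditions
  on forms of degree \<open>t\<close> and none of them lies on the line \<open>z = 0\<close>, then multiplication by \<open>z\<close>
  is injective on \<open>R / I\<^sup>2\<close> in degrees at least \<open>2 * t + 2\<close>, so \<open>I\<^sup>2\<close> agrees with the symbolic
  square in these degrees. Hence \<open>I\<^sup>(\<^sup>3\<^sup>)\<close> lies in \<open>I\<^sup>2\<close> as soon as no nonzero form of degree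
  \<open>2 * t + 1\<close> has a triple point at every point of the set. Both conditions are open, so each of
  them needs to be verified for a single configuration: the first for a triangular grid, the second
  for points distributed over few parallel lines, which are split off one after the other by
  counting intersections. For seven points the lines leave a cubic cone with too many zeros; for two
  points the second condition fails, but the only exceptional cubic is the cube of a line through
  both points.
\<close>

section \<open>Evaluation and grading of multivariate polynomials\<close>

text \<open>Modulo \<open>z\<close> the ideal agrees, in degrees from \<open>t + 1\<close> on, with
  the power \<open>(x, y) ^ (t + 1)\<close>, whose syzygies are linear. The bound
  \<open>2 * t + 2\<close> is the point from which the coefficients of these syzygies have degree at
  least \<open>t + 1\<close> and can be lifted. For the symbolic square, the forms of degree
  \<open>t\<close> dual to the points show that \<open>z ^ (3 * t)\<close> carries it into
  \<open>I\<^sup>2\<close>; the factors \<open>z\<close> are then cancelled. That no form of degree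
  \<open>2 * t + 1\<close> survives is suggested by a count: there are
  \<open>(t + 1) * (2 * t + 3)\<close> coefficients, while minimality of \<open>t\<close> gives
  \<open>n \<ge> t * (t + 1) / 2 + 1\<close> and hence at least \<open>3 * t * (t + 1) + 6\<close>
  conditions. The count is no proof, as the case \<open>n = 2\<close> shows, but its slack leaves
  room for very special positions of the points on lines. Since the characteristic is arbitrary,
  orders of vanishing are read off from the coefficients of a shifted polynomial and not from
  derivatives.\<close>

abbreviation lk where "lk \<equiv> Poly_Mapping.lookup"
abbreviation ks where "ks \<equiv> Poly_Mapping.keys"
abbreviation sg where "sg \<equiv> Poly_Mapping.single"

lemma poly_mapping_decomp: "F = (\<Sum>m\<in>ks F. sg m (lk F m))"
  by (rule poly_mapping_eqI)
    (auto simp: lookup_sum lookup_single when_def not_in_keys_iff_lookup_eq_zero sum.delta[OF finite_keys] if_distrib cong: if_cong)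

lemma poly_mapping_single_add_induct [case_names single add]:
  fixes F :: "'a \<Rightarrow>\<^sub>0 'b::comm_monoid_add"
  assumes "\<And>m c. P (sg m c)" "\<And>F G. P F \<Longrightarrow> P G \<Longrightarrow> P (F + G)"
  shows "P F"
proof -
  have "P (\<Sum>m\<in>A. sg m (lk F m))" if "finite A" for A
    using that
  proof induction
    case empty
    then show ?case using assms(1)[of undefined 0] by simp
  next
    case (insert x A)
    then show ?case using assms by simp
  qed
  then show ?thesis using poly_mapping_decomp[of F] by (metis finite_keys)
qed

section \<open>Substitution homomorphisms\<close>

definition mono_val :: "('v \<Rightarrow> 'a::comm_ring_1) \<Rightarrow> ('v \<Rightarrow>\<^sub>0 nat) \<Rightarrow> 'a" where
  "mono_val x m = (\<Prod>v\<in>ks m. x v ^ lk m v)"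

lemma mono_val_superset:
  "finite A \<Longrightarrow> ks m \<subseteq> A \<Longrightarrow> mono_val x m = (\<Prod>v\<in>A. x v ^ lk m v)"
  unfolding mono_val_def by (rule prod.mono_neutral_left) (auto simp: in_keys_iff)

lemma mono_val_UNIV: "mono_val x m = (\<Prod>v\<in>UNIV. x v ^ lk m v)" for x :: "'v::finite \<Rightarrow> _"
  by (rule mono_val_superset) auto

lemma mono_val_zero [simp]: "mono_val x 0 = 1"
  by (simp add: mono_val_def)

lemma mono_val_single [simp]: "mono_val x (sg v k) = x v ^ k"
  by (simp add: mono_val_def)

lemma mono_val_add: "mono_val x (m + m') = mono_val x m * mono_val x m'"
proof -
  let ?A = "ks m \<union> ks m'"
  have "ks (m + m') \<subseteq> ?A" by (rule keys_add)
  then show ?thesis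
    by (simp add: mono_val_superset[of ?A] lookup_add power_add prod.distrib)
qed

text \<open>Mapping coefficients by \<open>h\<close> while replacing variables by \<open>x\<close>
  makes evaluation, Taylor expansion, restriction to a line and passage to a line of tuples
  instances of one notion; \<open>subst_comp\<close> compares their composites.\<close>

definition subst_mpoly ::
    "('a::comm_ring_1 \<Rightarrow> 'b::comm_ring_1) \<Rightarrow> ('v \<Rightarrow> 'b) \<Rightarrow> ('v, 'a) mpoly \<Rightarrow> 'b" where
  "subst_mpoly h x F = (\<Sum>m\<in>ks F. h (lk F m) * mono_val x m)"

lemma eval_mpoly_subst: "eval_mpoly x F = subst_mpoly (\<lambda>c. c) x F"
  by (simp add: eval_mpoly_def subst_mpoly_def mono_val_def)

locale coeff_hom =
  fixes h :: "'a::comm_ring_1 \<Rightarrow> 'b::comm_ring_1"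
  assumes hom_add: "h (a + b) = h a + h b"
    and hom_mult: "h (a * b) = h a * h b"
    and hom_one [simp]: "h 1 = 1"
begin

lemma hom_zero [simp]: "h 0 = 0"
  using hom_add[of 0 0] by simp

lemma hom_uminus: "h (- a) = - h a"
  using hom_add[of a "- a"] by (simp add: eq_neg_iff_add_eq_0 add.commute)

lemma hom_diff: "h (a - b) = h a - h b"
  using hom_add[of a "- b"] by (simp add: hom_uminus)

lemma hom_sum: "h (sum f A) = (\<Sum>a\<in>A. h (f a))"
  by (induction A rule: infinite_finite_induct) (auto simp: hom_add)

lemma hom_prod: "h (prod f A) = (\<Prod>a\<in>A. h (f a))"
  by (induction A rule: infinite_finite_induct) (auto simp: hom_mult)

lemma hom_power: "h (a ^ n) = h a ^ n"
  by (induction n) (auto simp: hom_mult)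

lemma hom_mono_val: "h (mono_val x m) = mono_val (\<lambda>v. h (x v)) m"
  by (simp add: mono_val_def hom_prod hom_power)

lemma subst_superset:
  "finite A \<Longrightarrow> ks F \<subseteq> A \<Longrightarrow> subst_mpoly h x F = (\<Sum>m\<in>A. h (lk F m) * mono_val x m)"
  unfolding subst_mpoly_def by (rule sum.mono_neutral_left) (auto simp: in_keys_iff)

lemma subst_single: "subst_mpoly h x (sg m c) = h c * mono_val x m"
  by (cases "c = 0") (auto simp: subst_mpoly_def)

lemma subst_add: "subst_mpoly h x (F + G) = subst_mpoly h x F + subst_mpoly h x G"
proof -
  let ?A = "ks F \<union> ks G"
  have "ks (F + G) \<subseteq> ?A" by (rule keys_add)
  then show ?thesis
    by (simp add: subst_superset[of ?A] lookup_add hom_add distrib_right sum.distrib)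
qed

lemma subst_mult: "subst_mpoly h x (F * G) = subst_mpoly h x F * subst_mpoly h x G"
proof (induction F rule: poly_mapping_single_add_induct)
  case (single m c)
  show ?case
    by (induction G rule: poly_mapping_single_add_induct)
      (auto simp: subst_single subst_add mult_single hom_mult mono_val_add algebra_simps)
qed (simp add: subst_add algebra_simps)

lemma subst_one: "subst_mpoly h x 1 = 1"
  using subst_single[of x 0 1] by simp

end

lemma coeff_hom_id: "coeff_hom (\<lambda>c. c)"
  by unfold_locales auto

lemma coeff_hom_subst: "coeff_hom h \<Longrightarrow> coeff_hom (subst_mpoly h x)"
  by unfold_locales
    (auto simp: coeff_hom.subst_add coeff_hom.subst_mult coeff_hom.subst_one)

lemma coeff_hom_eval: "coeff_hom (eval_mpoly x)"
  using coeff_hom_subst[OF coeff_hom_id] by (simp add: eval_mpoly_subst[abs_def])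

interpretation eval: coeff_hom "eval_mpoly x" for x
  by (rule coeff_hom_eval)

lemma eval_single: "eval_mpoly x (sg m c) = c * mono_val x m"
  by (simp add: eval_mpoly_subst coeff_hom.subst_single[OF coeff_hom_id])

lemma subst_comp:
  assumes "coeff_hom h"
  shows "h (subst_mpoly g x F) = subst_mpoly (\<lambda>c. h (g c)) (\<lambda>v. h (x v)) F"
  using assms by (simp add: subst_mpoly_def coeff_hom.hom_sum coeff_hom.hom_mult coeff_hom.hom_mono_val)

section \<open>Total degree, forms and homogeneous components\<close>

definition tdeg :: "('v \<Rightarrow>\<^sub>0 nat) \<Rightarrow> nat" where
  "tdeg m = (\<Sum>v\<in>ks m. lk m v)"

lemma tdeg_superset: "finite A \<Longrightarrow> ks m \<subseteq> A \<Longrightarrow> tdeg m = (\<Sum>v\<in>A. lk m v)"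
  unfolding tdeg_def by (rule sum.mono_neutral_left) (auto simp: in_keys_iff)

lemma tdeg_add: "tdeg (m + m') = tdeg m + tdeg m'"
proof -
  let ?A = "ks m \<union> ks m'"
  have "ks (m + m') \<subseteq> ?A" by (rule keys_add)
  then show ?thesis by (simp add: tdeg_superset[of ?A] lookup_add sum.distrib)
qed

lemma tdeg_single [simp]: "tdeg (sg v k) = k"
  by (simp add: tdeg_def)

lemma tdeg_zero [simp]: "tdeg 0 = 0"
  by (simp add: tdeg_def)

lemma is_form_iff: "is_form d F \<longleftrightarrow> (\<forall>m\<in>ks F. tdeg m = d)"
  by (simp add: is_form_def tdeg_def)

lemma is_form_zero [simp]: "is_form d 0"
  by (simp add: is_form_iff)

lemma is_form_single: "tdeg m = d \<Longrightarrow> is_form d (sg m c)"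
  by (auto simp: is_form_iff)

lemma is_form_add: "is_form d F \<Longrightarrow> is_form d G \<Longrightarrow> is_form d (F + G)"
  unfolding is_form_iff using keys_add[of F G] by blast

lemma is_form_diff: "is_form d F \<Longrightarrow> is_form d G \<Longrightarrow> is_form d (F - G)"
  for F :: "('v, 'k::ab_group_add) mpoly"
  unfolding is_form_iff by (auto simp: in_keys_iff lookup_minus)

lemma is_form_uminus: "is_form d F \<Longrightarrow> is_form d (- F)"
  for F :: "('v, 'k::ab_group_add) mpoly"
  unfolding is_form_iff by (auto simp: in_keys_iff)

lemma is_form_sum: "(\<And>a. a \<in> A \<Longrightarrow> is_form d (f a)) \<Longrightarrow> is_form d (sum f A)"
  by (induction A rule: infinite_finite_induct) (auto simp: is_form_add)

lemma is_form_mult: "is_form d F \<Longrightarrow> is_form e G \<Longrightarrow> is_form (d + e) (F * G)"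
  unfolding is_form_iff using keys_mult[of F G] by (fastforce simp: tdeg_add)

lemma is_form_one: "is_form 0 (1 :: ('v, 'k::comm_ring_1) mpoly)"
  using is_form_single[of "0 :: 'v \<Rightarrow>\<^sub>0 nat" 0 "1::'k"] by simp

lemma is_form_power: "is_form d F \<Longrightarrow> is_form (d * k) (F ^ k)"
  for F :: "('v, 'k::comm_ring_1) mpoly"
  by (induction k) (auto intro: is_form_mult is_form_one)

definition scal :: "'k \<Rightarrow> ('v, 'k::comm_ring_1) mpoly" where
  "scal c = sg 0 c"

definition X :: "'v \<Rightarrow> ('v, 'k::comm_ring_1) mpoly" where
  "X v = sg (sg v 1) 1"

lemma is_form_scal: "is_form 0 (scal c)"
  by (simp add: scal_def is_form_single)

lemma is_form_X: "is_form 1 (X v)"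
  by (simp add: X_def is_form_single)

lemma is_form_scal_mult: "is_form d F \<Longrightarrow> is_form d (scal c * F)"
  using is_form_mult[OF is_form_scal] by fastforce

lemma is_form_X_mult: "is_form d F \<Longrightarrow> is_form (Suc d) (X v * F)"
  using is_form_mult[OF is_form_X] by fastforce

lemma is_form_X_power: "is_form k (X v ^ k)"
  using is_form_power[OF is_form_X, of k] by simp

lemma subst_X: "coeff_hom h \<Longrightarrow> subst_mpoly h x (X v) = x v"
  by (simp add: X_def coeff_hom.subst_single coeff_hom.hom_one)

lemma subst_scal: "coeff_hom h \<Longrightarrow> subst_mpoly h x (scal c) = h c"
  by (simp add: scal_def coeff_hom.subst_single)

lemma eval_X [simp]: "eval_mpoly x (X v) = x v"
  by (simp add: eval_mpoly_subst subst_X[OF coeff_hom_id])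

lemma eval_scal [simp]: "eval_mpoly x (scal c) = c"
  by (simp add: eval_mpoly_subst subst_scal[OF coeff_hom_id])

lemma mono_val_scale:
  "mono_val (\<lambda>v. c * x v) m = c ^ tdeg m * mono_val x m"
  by (simp add: mono_val_def tdeg_def power_mult_distrib prod.distrib power_sum)

lemma eval_form_scale:
  "is_form d F \<Longrightarrow> eval_mpoly (\<lambda>v. c * x v) F = c ^ d * eval_mpoly x F"
  by (simp add: eval_mpoly_subst subst_mpoly_def mono_val_scale is_form_iff sum_distrib_left
      mult.left_commute)

definition component :: "nat \<Rightarrow> ('v, 'k::comm_ring_1) mpoly \<Rightarrow> ('v, 'k) mpoly" where
  "component d F = (\<Sum>m | m \<in> ks F \<and> tdeg m = d. sg m (lk F m))"

lemma lookup_component: "lk (component d F) m = (if tdeg m = d then lk F m else 0)"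
  by (auto simp: component_def lookup_sum lookup_single when_def sum.delta if_distrib
      not_in_keys_iff_lookup_eq_zero cong: if_cong)

lemma is_form_component: "is_form d (component d F)"
  by (auto simp: is_form_iff in_keys_iff lookup_component split: if_splits)

lemma component_add: "component d (F + G) = component d F + component d G"
  by (rule poly_mapping_eqI) (simp add: lookup_component lookup_add)

lemma component_zero [simp]: "component d 0 = 0"
  by (rule poly_mapping_eqI) (simp add: lookup_component)

lemma component_single: "component d (sg m c) = (if tdeg m = d then sg m c else 0)"
  by (rule poly_mapping_eqI) (auto simp: lookup_component lookup_single when_def)

lemma component_form: "is_form e F \<Longrightarrow> component d F = (if d = e then F else 0)"
  by (rule poly_mapping_eqI) (auto simp: lookup_component is_form_iff in_keys_iff)

lemma sum_component: "F = (\<Sum>d\<in>tdeg ` ks F. component d F)"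
  by (rule poly_mapping_eqI)
    (auto simp: lookup_sum lookup_component sum.delta' in_keys_iff image_iff)

lemma component_mult: "component d (F * G) = (\<Sum>i\<le>d. component i F * component (d - i) G)"
proof (induction F rule: poly_mapping_single_add_induct)
  case (single m c)
  show ?case
  proof (induction G rule: poly_mapping_single_add_induct)
    case (single m' c')
    have "(\<Sum>i\<le>d. component i (sg m c) * component (d - i) (sg m' c'))
        = (\<Sum>i\<le>d. if i = tdeg m then (if tdeg m' = d - i then sg m c * sg m' c' else 0) else 0)"
      by (rule sum.cong) (auto simp: component_single)
    also have "\<dots> = component d (sg m c * sg m' c')"
      by (auto simp: sum.delta mult_single component_single tdeg_add)
    finally show ?case by simp
  qed (simp add: component_add distrib_left sum.distrib)
qed (simp add: component_add distrib_right sum.distrib)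

section \<open>Ideals\<close>

lemma module_times: "module ((*) :: 'r::comm_ring_1 \<Rightarrow> 'r \<Rightarrow> 'r)"
  by unfold_locales (auto simp: algebra_simps)

lemma ideal_gen_base: "b \<in> B \<Longrightarrow> b \<in> ideal_gen B"
  unfolding ideal_gen_def by (rule module.span_base[OF module_times])

lemma ideal_gen_zero: "0 \<in> ideal_gen B"
  unfolding ideal_gen_def by (rule module.span_zero[OF module_times])

lemma ideal_gen_add: "a \<in> ideal_gen B \<Longrightarrow> b \<in> ideal_gen B \<Longrightarrow> a + b \<in> ideal_gen B"
  unfolding ideal_gen_def by (rule module.span_add[OF module_times])

lemma ideal_gen_mult: "a \<in> ideal_gen B \<Longrightarrow> r * a \<in> ideal_gen B"
  unfolding ideal_gen_def by (rule module.span_scale[OF module_times])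

lemma ideal_gen_induct [consumes 1, case_names zero step]:
  assumes "a \<in> ideal_gen B" and "P 0"
    and "\<And>r b x. b \<in> B \<Longrightarrow> P x \<Longrightarrow> P (r * b + x)"
  shows "P a"
  using assms(1) unfolding ideal_gen_def
  by (rule module.span_induct_alt[OF module_times]) (use assms in auto)

definition is_ideal :: "'r::comm_ring_1 set \<Rightarrow> bool" where
  "is_ideal I \<longleftrightarrow> 0 \<in> I \<and> (\<forall>a\<in>I. \<forall>b\<in>I. a + b \<in> I) \<and> (\<forall>r. \<forall>a\<in>I. r * a \<in> I)"

lemma is_ideal_gen: "is_ideal (ideal_gen B)"
  by (simp add: is_ideal_def ideal_gen_zero ideal_gen_add ideal_gen_mult)

lemma is_ideal_sum: "is_ideal I \<Longrightarrow> (\<And>a. a \<in> A \<Longrightarrow> f a \<in> I) \<Longrightarrow> sum f A \<in> I"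
  by (induction A rule: infinite_finite_induct) (auto simp: is_ideal_def)

lemma ideal_gen_least: "is_ideal I \<Longrightarrow> B \<subseteq> I \<Longrightarrow> ideal_gen B \<subseteq> I"
proof
  fix a assume "is_ideal I" "B \<subseteq> I" "a \<in> ideal_gen B"
  from this(3,1,2) show "a \<in> I"
    by (induction rule: ideal_gen_induct) (auto simp: is_ideal_def)
qed

lemma ideal_mult_memb: "a \<in> I \<Longrightarrow> b \<in> J \<Longrightarrow> a * b \<in> ideal_mult I J"
  unfolding ideal_mult_def by (rule ideal_gen_base) auto

lemma is_ideal_mult: "is_ideal (ideal_mult I J)"
  by (simp add: ideal_mult_def is_ideal_gen)

lemma ideal_mult_subset:
  "is_ideal K \<Longrightarrow> (\<And>a b. a \<in> I \<Longrightarrow> b \<in> J \<Longrightarrow> a * b \<in> K) \<Longrightarrow> ideal_mult I J \<subseteq> K"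
  unfolding ideal_mult_def by (rule ideal_gen_least) auto

lemma is_ideal_power: "is_ideal (ideal_power I r)"
  by (cases r) (auto simp: is_ideal_mult, simp add: is_ideal_def)

lemma ideal_power_subset: "is_ideal I \<Longrightarrow> ideal_power I (Suc r) \<subseteq> ideal_power I r"
proof (induction r)
  case (Suc r)
  show ?case
    unfolding ideal_power.simps(2)[of I "Suc r"]
  proof (rule ideal_mult_subset)
    show "is_ideal (ideal_power I (Suc r))" by (rule is_ideal_power)
    show "a * b \<in> ideal_power I (Suc r)" if "a \<in> I" "b \<in> ideal_power I (Suc r)" for a b
      using that is_ideal_power[of I "Suc r"] by (auto simp: is_ideal_def)
  qed
qed auto

lemma ideal_power_one: "is_ideal I \<Longrightarrow> ideal_power I (Suc 0) \<subseteq> I"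
  by (simp, rule ideal_mult_subset) (auto simp: is_ideal_def, metis mult.commute)

lemma ideal_power2_memb: "a \<in> I \<Longrightarrow> b \<in> I \<Longrightarrow> a * b \<in> ideal_power I 2"
  using ideal_mult_memb[OF _ ideal_mult_memb[of b I 1 UNIV], of a I]
  by (simp add: numeral_2_eq_2)

lemma ideal_power2_subset:
  assumes "is_ideal I" "is_ideal K" "\<And>a b. a \<in> I \<Longrightarrow> b \<in> I \<Longrightarrow> a * b \<in> K"
  shows "ideal_power I 2 \<subseteq> K"
proof -
  have "ideal_mult I (ideal_power I (Suc 0)) \<subseteq> K"
    using ideal_power_one[OF assms(1)] by (intro ideal_mult_subset assms) auto
  then show ?thesis by (simp add: numeral_2_eq_2)
qed

section \<open>Divisibility by a variable\<close>

lemma UNIV_3': "(UNIV :: 3 set) = {0, 1, 2}"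
proof -
  have "card {0, 1, 2 :: 3} = card (UNIV :: 3 set)" by simp
  then show ?thesis by (metis card_subset_eq finite subset_UNIV)
qed

lemma cases_3: "(j :: 3) = 0 \<or> j = 1 \<or> j = 2"
  using UNIV_3' by blast

lemma poly_mapping_eqI_3: "lk k 0 = lk m 0 \<Longrightarrow> lk k 1 = lk m 1 \<Longrightarrow> lk k 2 = lk m 2 \<Longrightarrow> k = m"
  for k m :: "3 \<Rightarrow>\<^sub>0 'a::zero"
  by (rule poly_mapping_eqI) (metis cases_3)

lemma sum_3': "(\<Sum>j\<in>(UNIV :: 3 set). f j) = f 0 + f 1 + f 2"
  unfolding UNIV_3' by (simp add: add.assoc)

lemma prod_3': "(\<Prod>j\<in>(UNIV :: 3 set). f j) = f 0 * f 1 * f 2"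
  unfolding UNIV_3' by (simp add: mult.assoc)

lemma tdeg_3: "tdeg m = lk m 0 + lk m 1 + lk m 2" for m :: "3 \<Rightarrow>\<^sub>0 nat"
  by (simp add: tdeg_superset[of UNIV] sum_3')

lemma lookup_X_mult: "lk (X v * F) (sg v 1 + m) = lk F m"
proof (induction F rule: poly_mapping_single_add_induct)
  case (single k c)
  then show ?case by (auto simp: X_def mult_single lookup_single when_def)
qed (simp add: distrib_left lookup_add)

lemma keys_X_mult: "ks (X v * F) = (\<lambda>m. sg v 1 + m) ` ks F"
proof
  show "(\<lambda>m. sg v 1 + m) ` ks F \<subseteq> ks (X v * F)"
    by (auto simp: in_keys_iff lookup_X_mult simp del: One_nat_def)
  show "ks (X v * F) \<subseteq> (\<lambda>m. sg v 1 + m) ` ks F"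
    using keys_mult[of "X v" F] by (auto simp: X_def split: if_splits)
qed

lemma X_mult_cancel: "X v * F = X v * G \<longleftrightarrow> F = G"
  by (metis lookup_X_mult poly_mapping_eqI)

lemma is_form_X_mult_iff: "is_form (Suc d) (X v * F) \<longleftrightarrow> is_form d F"
  by (simp add: is_form_iff keys_X_mult tdeg_add)

text \<open>\<open>A\<close> collects the monomials free of the variable \<open>v\<close>. In degree
  0 the truncated \<open>d - 1\<close> would admit a nonzero constant \<open>B\<close>, hence the
  separate clause.\<close>

lemma split_var:
  fixes F :: "('v, 'k::comm_ring_1) mpoly"
  assumes "is_form d F"
  obtains A B where "F = A + X v * B" "is_form d A" "\<forall>m\<in>ks A. lk m v = 0"
    "is_form (d - 1) B" "d = 0 \<Longrightarrow> B = 0"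
proof -
  define A where "A = (\<Sum>m | m \<in> ks F \<and> lk m v = 0. sg m (lk F m))"
  define B where "B = (\<Sum>m | m \<in> ks F \<and> lk m v \<noteq> 0. sg (m - sg v 1) (lk F m))"
  have m: "m = sg v 1 + (m - sg v 1)" if "lk m v \<noteq> 0" for m :: "'v \<Rightarrow>\<^sub>0 nat"
    using that by (intro poly_mapping_eqI) (auto simp: lookup_add lookup_minus lookup_single when_def)
  have "F = (\<Sum>m\<in>ks F. sg m (lk F m))" by (rule poly_mapping_decomp)
  also have "\<dots> = A + (\<Sum>m | m \<in> ks F \<and> lk m v \<noteq> 0. sg m (lk F m))"
    unfolding A_def by (subst sum.union_disjoint[symmetric]) (auto intro!: sum.cong)
  also have "(\<Sum>m | m \<in> ks F \<and> lk m v \<noteq> 0. sg m (lk F m)) = X v * B"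
    unfolding B_def sum_distrib_left
    by (rule sum.cong) (use m in \<open>auto simp: X_def mult_single simp del: One_nat_def\<close>)
  finally have F: "F = A + X v * B" .
  have A: "is_form d A" unfolding A_def
    by (rule is_form_sum) (use assms in \<open>auto intro: is_form_single simp: is_form_iff\<close>)
  have keysA: "\<forall>m\<in>ks A. lk m v = 0"
    using keys_sum[of "\<lambda>m. sg m (lk F m)" "{m. m \<in> ks F \<and> lk m v = 0}"]
    by (auto simp: A_def split: if_splits)
  have td: "tdeg m = Suc (tdeg (m - sg v 1))" if "lk m v \<noteq> 0" for m :: "'v \<Rightarrow>\<^sub>0 nat"
    by (subst m[OF that], subst tdeg_add) simp
  have B: "is_form (d - 1) B" unfolding B_def
    by (rule is_form_sum) (use assms td in \<open>auto intro!: is_form_single simp: is_form_iff\<close>)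
  have "B = 0" if "d = 0"
    unfolding B_def by (rule sum.neutral) (use assms td that in \<open>auto simp: is_form_iff\<close>)
  then show thesis using that F A keysA B by blast
qed

lemma X_dvd_iff: "X v dvd F \<longleftrightarrow> (\<forall>m\<in>ks F. lk m v \<noteq> 0)"
  for F :: "('v, 'k::comm_ring_1) mpoly"
proof
  assume "X v dvd F"
  then show "\<forall>m\<in>ks F. lk m v \<noteq> 0"
    by (auto simp: dvd_def keys_X_mult lookup_add)
next
  assume *: "\<forall>m\<in>ks F. lk m v \<noteq> 0"
  have "X v dvd sg m (lk F m)" if "m \<in> ks F" for m
  proof -
    have "m = sg v 1 + (m - sg v 1)" using * that
      by (intro poly_mapping_eqI) (auto simp: lookup_add lookup_minus lookup_single when_def)
    then have "sg m (lk F m) = X v * sg (m - sg v 1) (lk F m)"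
      by (simp add: X_def mult_single)
    then show ?thesis by (rule dvdI)
  qed
  then show "X v dvd F"
    by (subst poly_mapping_decomp[of F]) (rule dvd_sum)
qed

lemma X_dvd_X_mult:
  assumes "v \<noteq> w" "X v dvd X w * F"
  shows "X v dvd F"
  using assms by (auto simp: X_dvd_iff keys_X_mult lookup_add lookup_single when_def)

lemma X_dvd_X_power_mult:
  assumes "v \<noteq> w" "X v dvd X w ^ k * F"
  shows "X v dvd F"
  using assms by (induction k) (auto simp: mult.assoc dest: X_dvd_X_mult)

text \<open>No monomial of \<open>P\<close> contains \<open>w\<close> while all those of
  \<open>X w * Q\<close> do, so nothing cancels in the sum, and divisibility by a variable is a
  condition on single monomials.\<close>

lemma X_dvd_split:
  fixes P Q :: "('v, 'k::comm_ring_1) mpoly"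
  assumes vw: "v \<noteq> w" and P: "\<forall>m\<in>ks P. lk m w = 0" and dvd: "X v dvd P + X w * Q"
  shows "X v dvd P" "X v dvd Q"
proof -
  have *: "lk (X w * Q) m = 0" if "m \<in> ks P" for m
    using P that by (metis X_dvd_iff dvd_triv_left in_keys_iff)
  show "X v dvd P" unfolding X_dvd_iff
  proof
    fix m assume m: "m \<in> ks P"
    then have "m \<in> ks (P + X w * Q)" using * by (auto simp: in_keys_iff lookup_add)
    then show "lk m v \<noteq> 0" using dvd by (auto simp: X_dvd_iff)
  qed
  then have "X v dvd X w * Q" using dvd by (simp add: dvd_add_right_iff)
  then show "X v dvd Q" using vw by (rule X_dvd_X_mult[rotated])
qed

lemma keys_X_power_mult_free:
  assumes "v \<noteq> w" "\<forall>m\<in>ks F. lk m v = 0"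
  shows "\<forall>m\<in>ks (X w ^ k * F). lk m v = 0"
  using assms(2)
  by (induction k) (auto simp: mult.assoc keys_X_mult lookup_add lookup_single when_def assms(1)[symmetric])

text \<open>The syzygies of the monomials \<open>x ^ a * y ^ (m - a)\<close> are generated by the linear ones.\<close>

lemma linear_syzygies:
  fixes h :: "nat \<Rightarrow> ('v, 'k::comm_ring_1) mpoly"
  assumes dist: "x \<noteq> y" "x \<noteq> z" "y \<noteq> z"
    and "\<And>a. a \<le> m \<Longrightarrow> is_form (Suc e) (h a)"
    and "X z dvd (\<Sum>a\<le>m. X x ^ a * X y ^ (m - a) * h a)"
  shows "\<exists>c. (\<forall>a. is_form e (c a)) \<and> c 0 = 0 \<and> c (Suc m) = 0 \<and>
    (\<forall>a\<le>m. X z dvd h a - (X y * c a - X x * c (Suc a)))"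
  using assms(4,5)
proof (induction m arbitrary: h)
  case 0
  then show ?case by (intro exI[of _ "\<lambda>_. 0"]) auto
next
  case (Suc m)
  obtain A B where h0: "h 0 = A + X x * B" and A: "\<forall>m\<in>ks A. lk m x = 0" and B: "is_form e B"
    using split_var[of "Suc e" "h 0" x] Suc.prems(1) by (metis diff_Suc_1 le0)
  \<comment> \<open>\<open>X y ^ Suc m * (X x * B)\<close> equals
    \<open>X x * X y ^ m * (X y * B)\<close>, so the part of \<open>h 0\<close> divisible by
    \<open>X x\<close> is moved into the next coefficient.\<close>
  define h' where "h' a = (if a = 0 then h 1 + X y * B else h (Suc a))" for a
  have "(\<Sum>a\<le>m. X x ^ a * X y ^ (m - a) * h' a)
      = (\<Sum>a\<le>m. X x ^ a * X y ^ (m - a) * h (Suc a)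
          + (if a = 0 then X y ^ Suc m * B else 0))"
    by (rule sum.cong) (auto simp: h'_def algebra_simps)
  also have "\<dots> = (\<Sum>a\<le>m. X x ^ a * X y ^ (m - a) * h (Suc a)) + X y ^ Suc m * B"
    by (simp add: sum.distrib)
  finally have h': "(\<Sum>a\<le>m. X x ^ a * X y ^ (m - a) * h' a)
      = (\<Sum>a\<le>m. X x ^ a * X y ^ (m - a) * h (Suc a)) + X y ^ Suc m * B" .
  have "(\<Sum>a\<le>Suc m. X x ^ a * X y ^ (Suc m - a) * h a)
      = X y ^ Suc m * h 0 + X x * (\<Sum>a\<le>m. X x ^ a * X y ^ (m - a) * h (Suc a))"
    by (subst sum.atMost_Suc_shift) (simp add: sum_distrib_left algebra_simps)
  also have "\<dots> = X y ^ Suc m * A + X x * (\<Sum>a\<le>m. X x ^ a * X y ^ (m - a) * h' a)"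
    unfolding h' h0 by (simp add: algebra_simps)
  finally have dvd: "X z dvd X y ^ Suc m * A + X x * (\<Sum>a\<le>m. X x ^ a * X y ^ (m - a) * h' a)"
    using Suc.prems(2) by simp
  note 1 = X_dvd_split[OF dist(2)[symmetric] keys_X_power_mult_free[OF dist(1) A] dvd]
  have zA: "X z dvd A" using X_dvd_X_power_mult[OF dist(3)[symmetric] 1(1)] .
  have "is_form (Suc e) (h' a)" if "a \<le> m" for a
    using that Suc.prems(1) B by (auto simp: h'_def intro: is_form_add is_form_X_mult)
  from Suc.IH[OF this 1(2)] obtain c where c: "\<forall>a. is_form e (c a)" "c 0 = 0" "c (Suc m) = 0"
    "\<And>a. a \<le> m \<Longrightarrow> X z dvd h' a - (X y * c a - X x * c (Suc a))"
    by blast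
  \<comment> \<open>The value \<open>- B\<close> at 1 records this transfer: it removes
    \<open>X x * B\<close> from \<open>h 0\<close> and leaves \<open>A\<close>, which is divisible
    by \<open>X z\<close>.\<close>
  define c' where "c' a = (if a = 0 then 0 else if a = 1 then - B else c (a - 1))" for a
  have c'2: "c' (Suc (Suc a)) = c (Suc a)" for a by (simp add: c'_def)
  show ?case
  proof (intro exI[of _ c'] conjI allI impI)
    show "is_form e (c' a)" for a using c(1) B by (auto simp: c'_def is_form_uminus)
    show "c' 0 = 0" "c' (Suc (Suc m)) = 0" using c by (auto simp: c'_def)
    fix a assume a: "a \<le> Suc m"
    consider "a = 0" | "a = 1" | b where "a = Suc (Suc b)"
      by (metis One_nat_def old.nat.exhaust)
    then show "X z dvd h a - (X y * c' a - X x * c' (Suc a))"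
    proof cases
      case 1 then show ?thesis using zA by (simp add: c'_def h0)
    next
      case 2 then show ?thesis using c(4)[of 0] c(2)
        by (simp add: c'_def h'_def c'2 algebra_simps)
    next
      case 3 then show ?thesis using c(4)[of "Suc b"] a
        by (simp add: c'2 h'_def)
    qed
  qed
qed

text \<open>Modulo \<open>z\<close> only monomials in \<open>x\<close> and \<open>y\<close> remain,
  and one of degree \<open>m + e\<close> is divisible by some \<open>x ^ b * y ^ (m - b)\<close>,
  with a quotient of degree \<open>e\<close>.\<close>

lemma form_mod_z:
  fixes F :: "(3, 'k::comm_ring_1) mpoly"
  assumes "is_form (m + e) F"
  shows "\<exists>c. (\<forall>b. is_form e (c b)) \<and>
    X 2 dvd F - (\<Sum>b\<le>m. c b * (X 0 ^ b * X 1 ^ (m - b)))"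
  using assms
proof (induction m arbitrary: F)
  case 0
  then show ?case by (intro exI[of _ "\<lambda>_. F"]) auto
next
  case (Suc m)
  obtain A' A where F1: "F = A' + X 0 * A" and A': "is_form (Suc m + e) A'"
    "\<forall>m\<in>ks A'. lk m 0 = 0" and A: "is_form (m + e) A"
    using split_var[OF Suc.prems, of 0] by (metis add_Suc diff_Suc_1)
  obtain C B where A'1: "A' = C + X 1 * B" and C: "is_form (Suc m + e) C"
    "\<forall>m\<in>ks C. lk m 1 = 0" and B: "is_form (m + e) B"
    using split_var[OF A'(1), of 1] by (metis add_Suc diff_Suc_1)
  \<comment> \<open>A monomial of \<open>C\<close> contains neither \<open>X 0\<close> nor
    \<open>X 1\<close> and has positive degree, so it is a power of \<open>X 2\<close>.\<close>
  have "X 2 dvd C"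
    unfolding X_dvd_iff
  proof
    fix k assume k: "k \<in> ks C"
    have "lk k 0 = 0"
    proof (cases "k \<in> ks A'")
      case True then show ?thesis using A'(2) by blast
    next
      case False
      then have "lk (X 1 * B) k \<noteq> 0" using k A'1 by (auto simp: in_keys_iff lookup_add)
      then have "lk k 1 \<noteq> 0" by (metis X_dvd_iff dvd_triv_left in_keys_iff)
      with C(2) k show ?thesis by simp
    qed
    moreover have "lk k 1 = 0" "tdeg k = Suc m + e" using C k by (auto simp: is_form_iff)
    ultimately show "lk k 2 \<noteq> 0" by (simp add: tdeg_3)
  qed
  moreover obtain a where a: "\<forall>b. is_form e (a b)"
    "X 2 dvd A - (\<Sum>b\<le>m. a b * (X 0 ^ b * X 1 ^ (m - b)))"
    using Suc.IH[OF A] by blast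
  moreover obtain b where b: "\<forall>i. is_form e (b i)"
    "X 2 dvd B - (\<Sum>i\<le>m. b i * (X 0 ^ i * X 1 ^ (m - i)))"
    using Suc.IH[OF B] by blast
  ultimately have dvd: "X 2 dvd C + X 0 * (A - (\<Sum>b\<le>m. a b * (X 0 ^ b * X 1 ^ (m - b))))
    + X 1 * (B - (\<Sum>i\<le>m. b i * (X 0 ^ i * X 1 ^ (m - i))))"
    by (intro dvd_add dvd_mult) auto
  define c where "c i = (if i = 0 then 0 else a (i - 1)) + (if i \<le> m then b i else 0)" for i
  have "(\<Sum>i\<le>Suc m. c i * (X 0 ^ i * X 1 ^ (Suc m - i)))
      = (\<Sum>i\<le>Suc m. (if i = 0 then 0 else a (i - 1)) * (X 0 ^ i * X 1 ^ (Suc m - i)))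
        + (\<Sum>i\<le>Suc m. (if i \<le> m then b i else 0) * (X 0 ^ i * X 1 ^ (Suc m - i)))"
    by (simp only: c_def distrib_right sum.distrib)
  also have "(\<Sum>i\<le>Suc m. (if i = 0 then 0 else a (i - 1)) * (X 0 ^ i * X 1 ^ (Suc m - i)))
      = X 0 * (\<Sum>b\<le>m. a b * (X 0 ^ b * X 1 ^ (m - b)))"
    by (subst sum.atMost_Suc_shift) (simp add: sum_distrib_left mult_ac)
  also have "(\<Sum>i\<le>Suc m. (if i \<le> m then b i else 0) * (X 0 ^ i * X 1 ^ (Suc m - i)))
      = X 1 * (\<Sum>i\<le>m. b i * (X 0 ^ i * X 1 ^ (m - i)))"
    by (simp add: sum_distrib_left mult_ac Suc_diff_le)
  finally have "F - (\<Sum>i\<le>Suc m. c i * (X 0 ^ i * X 1 ^ (Suc m - i)))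
    = C + X 0 * (A - (\<Sum>b\<le>m. a b * (X 0 ^ b * X 1 ^ (m - b))))
    + X 1 * (B - (\<Sum>i\<le>m. b i * (X 0 ^ i * X 1 ^ (m - i))))"
    by (simp add: F1 A'1 algebra_simps)
  then show ?case
    using dvd a(1) b(1) by (intro exI[of _ c]) (auto simp: c_def is_form_add)
qed

section \<open>Forms in the square of the ideal of a point set\<close>

text \<open>The forms \<open>e i\<close> are dual to the nodes: their existence says that the nodes
  impose independent conditions on forms of degree \<open>t\<close>. Fixed coordinate vectors
  \<open>v i\<close> are used so that values at nodes are field elements.\<close>

locale nodes =
  fixes n t :: nat and v :: "nat \<Rightarrow> 3 \<Rightarrow> 'k::field" and e :: "nat \<Rightarrow> (3, 'k) mpoly"
  assumes v2: "i < n \<Longrightarrow> v i 2 \<noteq> 0"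
    and form_e: "i < n \<Longrightarrow> is_form t (e i)"
    and eval_e: "i < n \<Longrightarrow> j < n \<Longrightarrow> eval_mpoly (v j) (e i) = (if i = j then 1 else 0)"
begin

definition I :: "nat \<Rightarrow> (3, 'k) mpoly set" where
  "I d = {F. is_form d F \<and> (\<forall>i<n. eval_mpoly (v i) F = 0)}"

lemma I_zero: "0 \<in> I d"
  by (simp add: I_def)

lemma I_add: "F \<in> I d \<Longrightarrow> G \<in> I d \<Longrightarrow> F + G \<in> I d"
  by (simp add: I_def is_form_add eval.hom_add)

lemma I_diff: "F \<in> I d \<Longrightarrow> G \<in> I d \<Longrightarrow> F - G \<in> I d"
  by (simp add: I_def is_form_diff eval.hom_diff)

lemma I_sum: "(\<And>a. a \<in> A \<Longrightarrow> f a \<in> I d) \<Longrightarrow> sum f A \<in> I d"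
  by (induction A rule: infinite_finite_induct) (auto simp: I_zero I_add)

lemma I_mult: "is_form a F \<Longrightarrow> G \<in> I b \<Longrightarrow> a + b = d \<Longrightarrow> F * G \<in> I d"
  by (auto simp: I_def is_form_mult eval.hom_mult)

lemma I_X_mult: "F \<in> I d \<Longrightarrow> X w * F \<in> I (Suc d)"
  using I_mult[OF is_form_X, of F d "Suc d"] by simp

lemma I_form: "F \<in> I d \<Longrightarrow> is_form d F"
  by (simp add: I_def)

lemma I_X2_cancel: "X 2 * F \<in> I (Suc d) \<Longrightarrow> F \<in> I d"
  using v2 by (auto simp: I_def is_form_X_mult_iff eval.hom_mult)

lemma I_divide: "F \<in> I (Suc d) \<Longrightarrow> X 2 dvd F \<Longrightarrow> \<exists>G\<in>I d. F = X 2 * G"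
  using I_X2_cancel by (auto simp: dvd_def)

text \<open>This works because the nodes impose independent conditions on forms of degree \<open>d - 1 \<ge> t\<close>.\<close>

lemma I_lift:
  assumes C: "is_form d C" and d: "d \<ge> Suc t"
  shows "\<exists>G\<in>I d. X 2 dvd C - G \<and> (C = 0 \<longrightarrow> G = 0)"
proof -
  obtain k where k: "d = t + Suc k" using d by (metis add_Suc_shift le_Suc_ex add_Suc_right)
  \<comment> \<open>A form of degree \<open>d - 1\<close> with the value of \<open>C / z\<close> at
    every node, so that \<open>C - z * H\<close> vanishes there. At its own node
    \<open>e i * z ^ k\<close> has the value of \<open>z ^ k\<close>, whence the exponent
    \<open>Suc k\<close> in the denominator.\<close>
  define H where "H = (\<Sum>i<n. scal (eval_mpoly (v i) C / v i 2 ^ Suc k) * (e i * X 2 ^ k))"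
  have formH: "is_form (t + k) H" unfolding H_def
    by (intro is_form_sum is_form_scal_mult is_form_mult is_form_X_power form_e) auto
  have evH: "eval_mpoly (v j) H = eval_mpoly (v j) C / v j 2" if j: "j < n" for j
  proof -
    have "eval_mpoly (v j) H = (\<Sum>i<n. if i = j then eval_mpoly (v j) C / v j 2 ^ Suc k * v j 2 ^ k else 0)"
      unfolding H_def eval.hom_sum by (rule sum.cong) (auto simp: eval.hom_mult eval.hom_power eval_e j)
    also have "\<dots> = eval_mpoly (v j) C / v j 2"
      using j v2[OF j] by (simp add: sum.delta)
    finally show ?thesis .
  qed
  have "C - X 2 * H \<in> I d"
    using C formH v2 by (auto simp: I_def k eval.hom_diff eval.hom_mult evH is_form_X_mult is_form_diff)
  moreover have "C = 0 \<longrightarrow> C - X 2 * H = 0"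
    by (simp add: H_def scal_def)
  ultimately show ?thesis by force
qed

text \<open>The part of degree \<open>D\<close> of the square of the ideal. Recording the degrees of
  both factors permits a pigeonhole argument on \<open>a + b = D\<close>; \<open>W_J\<close> and
  \<open>component_J_square\<close> connect it with \<open>ideal_power\<close>.\<close>

inductive_set W :: "nat \<Rightarrow> (3, 'k) mpoly set" for D where
  zero: "0 \<in> W D"
| step: "u \<in> I a \<Longrightarrow> u' \<in> I b \<Longrightarrow> a + b = D \<Longrightarrow> w \<in> W D \<Longrightarrow> u * u' + w \<in> W D"

lemma W_add: "w \<in> W D \<Longrightarrow> w' \<in> W D \<Longrightarrow> w + w' \<in> W D"
  by (induction rule: W.induct) (auto simp: add.assoc intro: W.intros)

lemma W_mult: "u \<in> I a \<Longrightarrow> u' \<in> I b \<Longrightarrow> a + b = D \<Longrightarrow> u * u' \<in> W D"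
  using W.step[OF _ _ _ W.zero] by fastforce

lemma W_sum: "(\<And>a. a \<in> A \<Longrightarrow> f a \<in> W D) \<Longrightarrow> sum f A \<in> W D"
  by (induction A rule: infinite_finite_induct) (auto simp: W.zero W_add)

lemma W_form_mult: "w \<in> W D \<Longrightarrow> is_form a F \<Longrightarrow> a + D = E \<Longrightarrow> F * w \<in> W E"
proof (induction rule: W.induct)
  case (step u p u' q w)
  then have "F * u * u' \<in> W E" by (intro W_mult[of _ "a + p" _ q] I_mult) auto
  then show ?case using step by (simp add: distrib_left mult.assoc W_add)
qed (simp add: W.zero)

text \<open>Liftings to the ideal of the \<open>t + 2\<close> monomials of degree
  \<open>t + 1\<close> in \<open>x\<close> and \<open>y\<close>. Up to multiples of \<open>z\<close>
  they generate the ideal in the higher degrees.\<close>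

definition leads :: "(nat \<Rightarrow> (3, 'k) mpoly) \<Rightarrow> bool" where
  "leads g \<longleftrightarrow> (\<forall>b\<le>Suc t. g b \<in> I (Suc t) \<and> X 2 dvd X 0 ^ b * X 1 ^ (Suc t - b) - g b)"

lemma leads_exist: "\<exists>g. leads g"
proof -
  have "\<exists>G. b \<le> Suc t \<longrightarrow> G \<in> I (Suc t) \<and> X 2 dvd X 0 ^ b * X 1 ^ (Suc t - b) - G" for b
  proof (cases "b \<le> Suc t")
    case True
    have "is_form (b + (Suc t - b)) (X 0 ^ b * X 1 ^ (Suc t - b) :: (3, 'k) mpoly)"
      by (intro is_form_mult is_form_X_power)
    then show ?thesis using I_lift[of "Suc t"] True by auto
  qed auto
  then show ?thesis unfolding leads_def by metis
qed

lemma I_expand: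
  assumes g: "leads g" and u: "u \<in> I a" and a: "Suc (Suc t) \<le> a"
  shows "\<exists>c u'. (\<forall>b. is_form (a - Suc t) (c b)) \<and> u' \<in> I (a - 1) \<and>
    u = (\<Sum>b\<le>Suc t. c b * g b) + X 2 * u'"
proof -
  have "is_form (Suc t + (a - Suc t)) u" using u a by (simp add: I_def)
  from form_mod_z[OF this] obtain c where c: "\<forall>b. is_form (a - Suc t) (c b)"
    "X 2 dvd u - (\<Sum>b\<le>Suc t. c b * (X 0 ^ b * X 1 ^ (Suc t - b)))" by blast
  have "X 2 dvd (\<Sum>b\<le>Suc t. c b * (X 0 ^ b * X 1 ^ (Suc t - b) - g b))"
    using g by (intro dvd_sum dvd_mult) (auto simp: leads_def)
  from dvd_add[OF c(2) this] have "X 2 dvd u - (\<Sum>b\<le>Suc t. c b * g b)"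
    by (simp add: right_diff_distrib sum_subtractf del: sum.atMost_Suc)
  moreover have "(\<Sum>b\<le>Suc t. c b * g b) \<in> I a"
    by (rule I_sum, rule I_mult[of "a - Suc t" _ _ "Suc t"]) (use c g a in \<open>auto simp: leads_def\<close>)
  moreover have "Suc (a - 1) = a" using a by simp
  ultimately obtain u' where u': "u' \<in> I (a - 1)" "u - (\<Sum>b\<le>Suc t. c b * g b) = X 2 * u'"
    using I_divide[of "u - (\<Sum>b\<le>Suc t. c b * g b)" "a - 1"]
      I_diff[OF u, of "\<Sum>b\<le>Suc t. c b * g b"] by (auto simp del: sum.atMost_Suc)
  have "u = (\<Sum>b\<le>Suc t. c b * g b) + X 2 * u'" unfolding u'(2)[symmetric] by simp
  then show ?thesis using c(1) u'(1) by blast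
qed

lemma W_expand:
  assumes g: "leads g" and D: "2 * t + 2 \<le> D" and w: "w \<in> W (Suc D)"
  shows "\<exists>h w'. (\<forall>b. h b \<in> I (D - t)) \<and> w' \<in> W D \<and> w = (\<Sum>b\<le>Suc t. g b * h b) + X 2 * w'"
  using w
proof (induction rule: W.induct)
  case zero
  show ?case by (intro exI[of _ "\<lambda>_. 0"] exI[of _ 0]) (auto simp: I_zero W.zero)
next
  case (step u a u' b w)
  have *: "\<exists>h w'. (\<forall>b. h b \<in> I (D - t)) \<and> w' \<in> W D \<and> u * u' = (\<Sum>b\<le>Suc t. g b * h b) + X 2 * w'"
    if u: "u \<in> I a" "u' \<in> I b" "a + b = Suc D" "Suc (Suc t) \<le> a" for u u' a b
  proof -
    obtain c q where c: "\<forall>b. is_form (a - Suc t) (c b)" "q \<in> I (a - 1)"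
      "u = (\<Sum>b\<le>Suc t. c b * g b) + X 2 * q"
      using I_expand[OF g u(1,4)] by blast
    have "c i * u' \<in> I (D - t)" for i
      using u c by (intro I_mult[of "a - Suc t" _ _ b]) auto
    moreover have "q * u' \<in> W D" using u c by (intro W_mult[of _ "a - 1" _ b]) auto
    moreover have "u * u' = (\<Sum>b\<le>Suc t. g b * (c b * u')) + X 2 * (q * u')"
      by (simp add: c(3) sum_distrib_left sum_distrib_right algebra_simps del: sum.atMost_Suc)
    ultimately show ?thesis by (intro exI[of _ "\<lambda>i. c i * u'"] exI[of _ "q * u'"]) simp
  qed
  \<comment> \<open>The degrees add up to at least \<open>2 * t + 3\<close>, so one of the two
    factors can be expanded in the leads.\<close>
  have "Suc (Suc t) \<le> a \<or> Suc (Suc t) \<le> b" using D step.hyps by linarith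
  then obtain h w' where 1: "\<forall>b. h b \<in> I (D - t)" "w' \<in> W D"
    "u * u' = (\<Sum>b\<le>Suc t. g b * h b) + X 2 * w'"
    using *[of u a u' b] *[of u' b u a] step.hyps by (auto simp: mult.commute add.commute)
  obtain h2 w2 where 2: "\<forall>b. h2 b \<in> I (D - t)" "w2 \<in> W D"
    "w = (\<Sum>b\<le>Suc t. g b * h2 b) + X 2 * w2"
    using step.IH by blast
  have "u * u' + w = (\<Sum>b\<le>Suc t. g b * (h b + h2 b)) + X 2 * (w' + w2)"
    by (simp add: 1(3) 2(3) distrib_left sum.distrib add_ac del: sum.atMost_Suc)
  then show ?case using 1 2 by (intro exI[of _ "\<lambda>b. h b + h2 b"] exI[of _ "w' + w2"]) (auto simp: I_add W_add)
qed

text \<open>Multiplication by \<open>z\<close> is injective on \<open>R / I\<^sup>2\<close> in degrees \<open>D \<ge> 2 * t + 2\<close>: the relation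
  between the leading terms of the \<open>h b\<close> is a combination of linear syzygies whose coefficients
  have degree at least \<open>t + 1\<close> and hence can be lifted to elements of the ideal.\<close>

lemma W_X2_cancel:
  assumes D: "2 * t + 2 \<le> D" and f: "X 2 * f \<in> W (Suc D)"
  shows "f \<in> W D"
proof -
  obtain g where g: "leads g" using leads_exist by blast
  obtain h w where h: "\<And>b. h b \<in> I (D - t)" and w: "w \<in> W D"
    and f_eq: "X 2 * f = (\<Sum>b\<le>Suc t. g b * h b) + X 2 * w"
    using W_expand[OF g D f] by blast
  define d where "d = D - t - 1"
  \<comment> \<open>Here the bound on \<open>D\<close> enters: the syzygy coefficients have degree
    \<open>d \<ge> t + 1\<close>, the range of \<open>I_lift\<close>.\<close>
  have d: "D - t = Suc d" "Suc t \<le> d" using D by (auto simp: d_def)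
  have "(\<Sum>b\<le>Suc t. g b * h b) = X 2 * (f - w)" using f_eq by (simp add: algebra_simps)
  then have "X 2 dvd (\<Sum>b\<le>Suc t. g b * h b)" by simp
  moreover have "X 2 dvd (\<Sum>b\<le>Suc t. (X 0 ^ b * X 1 ^ (Suc t - b) - g b) * h b)"
    using g by (intro dvd_sum dvd_mult2) (auto simp: leads_def)
  ultimately have "X 2 dvd (\<Sum>b\<le>Suc t. g b * h b) + (\<Sum>b\<le>Suc t. (X 0 ^ b * X 1 ^ (Suc t - b) - g b) * h b)"
    by (rule dvd_add)
  then have "X 2 dvd (\<Sum>b\<le>Suc t. X 0 ^ b * X 1 ^ (Suc t - b) * h b)"
    by (simp add: left_diff_distrib sum_subtractf)
  then obtain c where c: "\<forall>a. is_form d (c a)" "c 0 = 0" "c (Suc (Suc t)) = 0"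
    "\<And>a. a \<le> Suc t \<Longrightarrow> X 2 dvd h a - (X 1 * c a - X 0 * c (Suc a))"
    using linear_syzygies[of 0 1 2 "Suc t" d h] h I_form d(1) by auto
  \<comment> \<open>The lifting preserves the zeros \<open>c 0\<close> and
    \<open>c (Suc (Suc t))\<close> at both ends.\<close>
  have "\<exists>C. \<forall>a. C a \<in> I d \<and> X 2 dvd c a - C a \<and> (c a = 0 \<longrightarrow> C a = 0)"
    using I_lift[OF c(1)[rule_format] d(2)] by metis
  then obtain C where C: "\<And>a. C a \<in> I d" "\<And>a. X 2 dvd c a - C a" "C 0 = 0" "C (Suc (Suc t)) = 0"
    using c by blast
  have "\<exists>H\<in>I d. h a - (X 1 * C a - X 0 * C (Suc a)) = X 2 * H" if a: "a \<le> Suc t" for a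
  proof (rule I_divide)
    show "h a - (X 1 * C a - X 0 * C (Suc a)) \<in> I (Suc d)"
      using h[of a] C(1) d by (auto intro!: I_diff I_X_mult)
    have "X 2 dvd (h a - (X 1 * c a - X 0 * c (Suc a))) + (X 1 * (c a - C a) - X 0 * (c (Suc a) - C (Suc a)))"
      by (intro dvd_add dvd_diff dvd_mult c(4)[OF a] C(2))
    then show "X 2 dvd h a - (X 1 * C a - X 0 * C (Suc a))" by (simp add: algebra_simps)
  qed
  then obtain H where H: "\<And>a. a \<le> Suc t \<Longrightarrow> H a \<in> I d"
    "\<And>a. a \<le> Suc t \<Longrightarrow> h a - (X 1 * C a - X 0 * C (Suc a)) = X 2 * H a"
    by metis
  \<comment> \<open>The leads satisfy the linear syzygies of the monomials up to a multiple of
    \<open>z\<close>; the cofactor lies again in the ideal because no node lies on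
    \<open>z = 0\<close>.\<close>
  have "\<exists>q\<in>I (Suc t). X 1 * g (Suc a) - X 0 * g a = X 2 * q" if a: "a \<le> t" for a
  proof (rule I_divide)
    show "X 1 * g (Suc a) - X 0 * g a \<in> I (Suc (Suc t))"
      using g a by (auto intro!: I_diff I_X_mult simp: leads_def)
    have "X 2 dvd X 0 * (X 0 ^ a * X 1 ^ (Suc t - a) - g a)
        - X 1 * (X 0 ^ Suc a * X 1 ^ (Suc t - Suc a) - g (Suc a))"
      using g a unfolding leads_def by (intro dvd_diff[OF dvd_mult dvd_mult]) auto
    then show "X 2 dvd X 1 * g (Suc a) - X 0 * g a"
      using a by (simp add: algebra_simps Suc_diff_le)
  qed
  then obtain q where q: "\<And>a. a \<le> t \<Longrightarrow> q a \<in> I (Suc t)"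
    "\<And>a. a \<le> t \<Longrightarrow> X 1 * g (Suc a) - X 0 * g a = X 2 * q a"
    by metis
  have "(\<Sum>b\<le>Suc t. g b * h b) = (\<Sum>b\<le>Suc t. g b * (X 1 * C b - X 0 * C (Suc b)) + X 2 * (g b * H b))"
  proof (rule sum.cong)
    fix b assume "b \<in> {..Suc t}"
    then have "h b = (X 1 * C b - X 0 * C (Suc b)) + X 2 * H b" using H(2)[of b]
      by (simp add: algebra_simps)
    then show "g b * h b = g b * (X 1 * C b - X 0 * C (Suc b)) + X 2 * (g b * H b)"
      by (simp only: distrib_left mult_ac)
  qed simp
  also have "\<dots> = (\<Sum>b\<le>Suc t. g b * (X 1 * C b)) - (\<Sum>b\<le>Suc t. g b * (X 0 * C (Suc b)))
      + X 2 * (\<Sum>b\<le>Suc t. g b * H b)"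
    by (simp only: sum.distrib right_diff_distrib sum_subtractf sum_distrib_left)
  \<comment> \<open>Summation by parts; the boundary terms vanish with \<open>C 0\<close> and
    \<open>C (Suc (Suc t))\<close>.\<close>
  also have "(\<Sum>b\<le>Suc t. g b * (X 1 * C b)) = (\<Sum>b\<le>t. g (Suc b) * (X 1 * C (Suc b)))"
    by (subst sum.atMost_Suc_shift) (simp add: C)
  also have "(\<Sum>b\<le>Suc t. g b * (X 0 * C (Suc b))) = (\<Sum>b\<le>t. g b * (X 0 * C (Suc b)))"
    by (simp add: C)
  also have "(\<Sum>b\<le>t. g (Suc b) * (X 1 * C (Suc b))) - (\<Sum>b\<le>t. g b * (X 0 * C (Suc b)))
      = (\<Sum>b\<le>t. C (Suc b) * (X 1 * g (Suc b) - X 0 * g b))"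
    by (simp add: sum_subtractf[symmetric] algebra_simps)
  also have "\<dots> = X 2 * (\<Sum>b\<le>t. C (Suc b) * q b)"
    by (simp add: q(2) sum_distrib_left mult_ac)
  finally have "X 2 * f = X 2 * ((\<Sum>b\<le>t. C (Suc b) * q b) + (\<Sum>b\<le>Suc t. g b * H b) + w)"
    by (simp add: f_eq distrib_left)
  then have f_sum: "f = (\<Sum>b\<le>t. C (Suc b) * q b) + (\<Sum>b\<le>Suc t. g b * H b) + w"
    by (simp only: X_mult_cancel)
  show "f \<in> W D" unfolding f_sum
  proof (intro W_add W_sum w)
    show "C (Suc b) * q b \<in> W D" if "b \<in> {..t}" for b
      using that C(1) q(1) D by (intro W_mult[of _ d _ "Suc t"]) (auto simp: d_def)
    show "g b * H b \<in> W D" if "b \<in> {..Suc t}" for b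
      using that H(1) g D by (intro W_mult[of _ "Suc t" _ d]) (auto simp: d_def leads_def)
  qed
qed

section \<open>From the symbolic square to the ordinary square\<close>

definition J :: "(3, 'k) mpoly set" where
  "J = ideal_gen (\<Union>d. I d)"

definition P :: "nat \<Rightarrow> (3, 'k) mpoly set" where
  "P i = ideal_gen {F. (\<exists>d. is_form d F) \<and> eval_mpoly (v i) F = 0}"

lemma ideal_J: "is_ideal J"
  by (simp add: J_def is_ideal_gen)

lemma I_J: "F \<in> I d \<Longrightarrow> F \<in> J"
  unfolding J_def by (rule ideal_gen_base) auto

lemma W_J: "w \<in> W D \<Longrightarrow> w \<in> ideal_power J 2"
proof (induction rule: W.induct)
  case (step u a u' b w)
  then have "u * u' \<in> ideal_power J 2" by (intro ideal_power2_memb I_J)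
  then show ?case using step.IH is_ideal_power[of J 2] unfolding is_ideal_def by blast
qed (use is_ideal_power[of J 2] in \<open>simp add: is_ideal_def\<close>)

text \<open>\<open>e i\<close> vanishes at all other nodes, so multiplication by it turns vanishing
  at one node into vanishing at all of them.\<close>

lemma e_mult_P: "i < n \<Longrightarrow> F \<in> P i \<Longrightarrow> e i * F \<in> J"
proof -
  assume i: "i < n" and "F \<in> P i"
  then have "F \<in> {F. e i * F \<in> J}" unfolding P_def
  proof (elim set_rev_mp[OF _ ideal_gen_least])
    show "is_ideal {F. e i * F \<in> J}"
      using ideal_J by (auto simp: is_ideal_def distrib_left mult.left_commute)
    show "{F. (\<exists>d. is_form d F) \<and> eval_mpoly (v i) F = 0} \<subseteq> {F. e i * F \<in> J}"
    proof safe
      fix F d assume F: "is_form d F" "eval_mpoly (v i) F = 0"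
      have "e i * F \<in> I (t + d)"
        using F form_e[OF i] eval_e[OF i] by (auto simp: I_def is_form_mult eval.hom_mult)
      then show "e i * F \<in> J" by (rule I_J)
    qed
  qed
  then show "e i * F \<in> J" by simp
qed

text \<open>Interpolation writes \<open>z ^ t\<close> as a combination of the \<open>e i\<close>
  plus some \<open>j\<close> in \<open>J\<close>. Three such factors suffice:
  \<open>e i * e i\<close> brings \<open>F\<close> into the square because \<open>e i\<close> brings
  each factor from \<open>P i\<close> into \<open>J\<close>, while \<open>j\<close> and the mixed
  products \<open>e i * e k\<close> lie in \<open>J\<close> and meet \<open>z ^ t * F\<close>, which
  lies in \<open>J\<close> as well.\<close>

lemma X2_power_in_square:
  assumes F: "\<And>i. i < n \<Longrightarrow> F \<in> ideal_power (P i) 2"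
  shows "X 2 ^ (3 * t) * F \<in> ideal_power J 2"
proof -
  let ?z = "X 2 ^ t" and ?c = "\<lambda>i. scal (v i 2 ^ t) :: (3, 'k) mpoly"
  have idP: "is_ideal (P i)" for i by (simp add: P_def is_ideal_gen)
  have FP: "F \<in> P i" if "i < n" for i
    using F[OF that] ideal_power_subset[OF idP, of i 1] ideal_power_one[OF idP, of i]
    by (auto simp: numeral_2_eq_2 simp del: ideal_power.simps)
  define j where "j = ?z - (\<Sum>i<n. ?c i * e i)"
  have "j \<in> I t" unfolding j_def I_def
  proof (safe)
    show "is_form t (?z - (\<Sum>i<n. ?c i * e i))"
      by (intro is_form_diff is_form_sum is_form_scal_mult is_form_X_power form_e) auto
    fix i assume i: "i < n"
    have "(\<Sum>k<n. v k 2 ^ t * eval_mpoly (v i) (e k)) = (\<Sum>k<n. if k = i then v i 2 ^ t else 0)"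
      by (rule sum.cong) (auto simp: eval_e i)
    then show "eval_mpoly (v i) (?z - (\<Sum>i<n. ?c i * e i)) = 0"
      using i by (simp add: eval.hom_diff eval.hom_sum eval.hom_mult eval.hom_power sum.delta)
  qed
  then have jJ: "j \<in> J" by (rule I_J)
  have z: "?z = (\<Sum>i<n. ?c i * e i) + j" by (simp add: j_def)
  have J_add: "a + b \<in> J" if "a \<in> J" "b \<in> J" for a b using ideal_J that by (simp add: is_ideal_def)
  have J_mult: "r * a \<in> J" if "a \<in> J" for a r using ideal_J that by (simp add: is_ideal_def)
  let ?K = "ideal_power J 2"
  have K: "is_ideal ?K" by (rule is_ideal_power)
  have K_add: "a + b \<in> ?K" if "a \<in> ?K" "b \<in> ?K" for a b using K that by (simp add: is_ideal_def)
  have K_mult: "r * a \<in> ?K" if "a \<in> ?K" for a r using K that by (simp add: is_ideal_def)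
  have eF: "e i * F \<in> J" if "i < n" for i using e_mult_P[OF that FP[OF that]] .
  have zF: "?z * F \<in> J"
  proof -
    have "?z * F = (\<Sum>i<n. ?c i * (e i * F)) + F * j"
      by (subst z) (simp add: sum_distrib_left sum_distrib_right algebra_simps)
    also have "\<dots> \<in> J" by (intro J_add is_ideal_sum[OF ideal_J] J_mult jJ eF) auto
    finally show ?thesis .
  qed
  have ee: "e i * e i * F \<in> ?K" if i: "i < n" for i
  proof -
    have "ideal_power (P i) 2 \<subseteq> {F. e i * e i * F \<in> ?K}"
    proof (rule ideal_power2_subset[OF idP])
      show "is_ideal {F. e i * e i * F \<in> ?K}"
        using K by (auto simp: is_ideal_def distrib_left mult.left_commute[of "e i * e i"])
      show "a * b \<in> {F. e i * e i * F \<in> ?K}" if "a \<in> P i" "b \<in> P i" for a b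
        using ideal_power2_memb[OF e_mult_P[OF i that(1)] e_mult_P[OF i that(2)]]
        by (simp add: mult_ac)
    qed
    then show ?thesis using F[OF i] by blast
  qed
  have eek: "e i * e k * F * ?z \<in> ?K" if i: "i < n" and k: "k < n" and "i \<noteq> k" for i k
  proof -
    have "e i * e k \<in> I (t + t)"
      using that form_e eval_e by (auto simp: I_def is_form_mult eval.hom_mult)
    then have "e i * e k * (?z * F) \<in> ?K" by (intro ideal_power2_memb zF I_J)
    then show ?thesis by (simp add: mult_ac)
  qed
  \<comment> \<open>One more factor \<open>z ^ t\<close> is expanded; the term \<open>k = i\<close>
    is a multiple of \<open>e i * e i * F\<close>, the other terms contain a mixed product.\<close>
  have ezz: "e i * F * ?z * ?z \<in> ?K" if i: "i < n" for i
  proof -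
    have "e i * F * ?z * ?z = ((\<Sum>k<n. ?c k * e k) + j) * (e i * F * ?z)"
      by (subst (1) z) (simp add: mult_ac)
    also have "\<dots> = (\<Sum>k<n. ?c k * (e i * e k * F * ?z)) + j * (e i * (?z * F))"
      by (simp add: sum_distrib_left sum_distrib_right algebra_simps)
    also have "\<dots> \<in> ?K"
    proof (rule K_add[OF is_ideal_sum[OF K K_mult] ideal_power2_memb[OF jJ J_mult[OF zF]]])
      fix k assume "k \<in> {..<n}"
      then show "e i * e k * F * ?z \<in> ?K"
        using eek[OF i, of k] K_mult[OF ee[OF i], of ?z] by (cases "k = i") (auto simp: mult_ac)
    qed
    finally show ?thesis .
  qed
  have "X 2 ^ (3 * t) * F = ((\<Sum>i<n. ?c i * e i) + j) * (F * ?z * ?z)"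
  proof -
    have "3 * t = t + t + t" by simp
    then have "(X 2 :: (3, 'k) mpoly) ^ (3 * t) = ?z * ?z * ?z" by (simp only: power_add)
    then show ?thesis by (subst z[symmetric]) (simp add: mult_ac)
  qed
  also have "\<dots> = (\<Sum>i<n. ?c i * (e i * F * ?z * ?z)) + ?z * (j * (?z * F))"
    by (simp add: sum_distrib_left sum_distrib_right algebra_simps)
  also have "\<dots> \<in> ?K"
    by (rule K_add[OF is_ideal_sum[OF K K_mult[OF ezz]] K_mult[OF ideal_power2_memb[OF jJ zF]]]) auto
  finally show ?thesis .
qed

lemma component_J: "F \<in> J \<Longrightarrow> component d F \<in> I d"
proof -
  have "J \<subseteq> {F. \<forall>d. component d F \<in> I d}" unfolding J_def
  proof (rule ideal_gen_least)
    show "is_ideal {F. \<forall>d. component d F \<in> I d}"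
      by (auto simp: is_ideal_def I_zero component_add I_add component_mult
          intro!: I_sum I_mult[OF is_form_component])
    show "(\<Union>d. I d) \<subseteq> {F. \<forall>d. component d F \<in> I d}"
      using component_form[OF I_form] I_zero by auto
  qed
  then show "F \<in> J \<Longrightarrow> component d F \<in> I d" by blast
qed

lemma component_J_square: "F \<in> ideal_power J 2 \<Longrightarrow> component d F \<in> W d"
proof -
  have "ideal_power J 2 \<subseteq> {F. \<forall>d. component d F \<in> W d}"
  proof (rule ideal_power2_subset[OF ideal_J])
    show "is_ideal {F. \<forall>d. component d F \<in> W d}"
      by (auto simp: is_ideal_def W.zero component_add W_add component_mult
          intro!: W_sum W_form_mult[OF _ is_form_component])
    show "a * b \<in> {F. \<forall>d. component d F \<in> W d}" if "a \<in> J" "b \<in> J" for a b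
      using that by (auto simp: component_mult intro!: W_sum W_mult component_J)
  qed
  then show "F \<in> ideal_power J 2 \<Longrightarrow> component d F \<in> W d" by blast
qed

lemma component_X_mult: "component (Suc d) (X w * F) = X w * component d F"
proof -
  have "component (Suc d) (X w * F) = (\<Sum>i\<le>Suc d. if i = 1 then X w * component d F else 0)"
    unfolding component_mult by (rule sum.cong) (auto simp: component_form[OF is_form_X])
  then show ?thesis by (simp add: sum.delta)
qed

text \<open>Multiplication by \<open>z ^ (3 * t)\<close> reaches the square, and every single
  cancellation of \<open>z\<close> takes place in a degree at least \<open>d\<close>, where
  \<open>W_X2_cancel\<close> applies.\<close>

lemma component_in_J_square:
  assumes F: "\<And>i. i < n \<Longrightarrow> F \<in> ideal_power (P i) 2" and d: "2 * t + 2 \<le> d"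
  shows "component d F \<in> ideal_power J 2"
proof -
  have component_X: "component (k + d) (X 2 ^ k * F) = X 2 ^ k * component d F" for k
    by (induction k) (auto simp: component_X_mult mult.assoc)
  have "X 2 ^ k * component d F \<in> W (k + d) \<Longrightarrow> component d F \<in> W d" for k
  proof (induction k)
    case (Suc k)
    then have "X 2 ^ k * component d F \<in> W (k + d)"
      using d W_X2_cancel[of "k + d" "X 2 ^ k * component d F"] by (simp add: mult.assoc)
    then show ?case by (rule Suc.IH)
  qed simp
  from this[of "3 * t"] show ?thesis
    using component_J_square[OF X2_power_in_square[OF F], of "3 * t + d"] by (auto simp: component_X W_J)
qed

lemma sum_components_in_J_square:
  assumes F: "\<And>i. i < n \<Longrightarrow> F \<in> ideal_power (P i) 2"
    and order_ge: "\<And>d. d \<le> 2 * t + 1 \<Longrightarrow> component d F \<in> ideal_power J 2"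
  shows "F \<in> ideal_power J 2"
proof -
  have "component d F \<in> ideal_power J 2" for d
    using component_in_J_square[OF F, of d] order_ge[of d] by (cases "d \<le> 2 * t + 1") auto
  then show ?thesis
    by (subst sum_component) (auto intro!: is_ideal_sum is_ideal_power)
qed

end

section \<open>Orders of vanishing\<close>

text \<open>The order of vanishing at the origin, with the outer and the inner variable of
  \<open>q\<close> as the two local coordinates. Coefficients, unlike derivatives, give the right
  notion in every characteristic.\<close>

definition order_ge :: "nat \<Rightarrow> 'k::comm_ring_1 poly poly \<Rightarrow> bool" where
  "order_ge m q \<longleftrightarrow> (\<forall>i j. i + j < m \<longrightarrow> coeff (coeff q i) j = 0)"

lemma order_ge_zero [simp]: "order_ge m 0"
  by (simp add: order_ge_def)

lemma order_ge_0 [simp]: "order_ge 0 q"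
  by (simp add: order_ge_def)

lemma order_ge_add: "order_ge m p \<Longrightarrow> order_ge m q \<Longrightarrow> order_ge m (p + q)"
  by (simp add: order_ge_def)

lemma order_ge_diff: "order_ge m p \<Longrightarrow> order_ge m q \<Longrightarrow> order_ge m (p - q)"
  by (simp add: order_ge_def)

lemma order_ge_sum: "(\<And>a. a \<in> A \<Longrightarrow> order_ge m (f a)) \<Longrightarrow> order_ge m (sum f A)"
  by (induction A rule: infinite_finite_induct) (auto intro: order_ge_add)

lemma order_ge_mult:
  assumes "order_ge a p" "order_ge b q"
  shows "order_ge (a + b) (p * q)"
  unfolding order_ge_def
proof (intro allI impI)
  fix i j assume ij: "i + j < a + b"
  have "coeff (coeff p r) s * coeff (coeff q (i - r)) (j - s) = 0" if "r \<le> i" "s \<le> j" for r s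
  proof (cases "r + s < a")
    case True then show ?thesis using assms(1) by (simp add: order_ge_def)
  next
    case False
    then have "(i - r) + (j - s) < b" using ij that by linarith
    then show ?thesis using assms(2) by (simp add: order_ge_def)
  qed
  then show "coeff (coeff (p * q) i) j = 0"
    by (simp add: coeff_mult coeff_sum)
qed

lemma order_ge_mult_left: "order_ge m q \<Longrightarrow> order_ge m (p * q)"
  using order_ge_mult[of 0 p m q] by simp

lemma order_ge_u_mult: "order_ge (Suc m) ([:0, 1:] * q) \<Longrightarrow> order_ge m q"
  unfolding order_ge_def
proof (intro allI impI)
  fix i j assume *: "\<forall>i j. i + j < Suc m \<longrightarrow> coeff (coeff ([:0, 1:] * q) i) j = 0" "i + j < m"
  then show "coeff (coeff q i) j = 0" using *(1)[rule_format, of "Suc i" j] by simp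
qed

text \<open>\<open>c + u\<close> is a unit in the local ring at the origin; the coefficients of
  \<open>q\<close> are recovered from those of the product by induction on the power of
  \<open>u\<close>.\<close>

lemma order_ge_unit_mult:
  fixes q :: "'k::field poly poly"
  assumes "order_ge m ([:[:c:], 1:] * q)" and c: "c \<noteq> 0"
  shows "order_ge m q"
proof -
  have eq: "coeff (coeff ([:[:c:], 1:] * q) i) j
      = c * coeff (coeff q i) j + (case i of 0 \<Rightarrow> 0 | Suc i \<Rightarrow> coeff (coeff q i) j)" for i j
    by (cases i) simp_all
  have "i + j < m \<longrightarrow> coeff (coeff q i) j = 0" for i j
  proof (induction i)
    case 0
    show ?case using assms(1)[unfolded order_ge_def, rule_format, of 0 j] eq[of 0 j] c by simp
  next
    case (Suc i)
    show ?case using assms(1)[unfolded order_ge_def, rule_format, of "Suc i" j] eq[of "Suc i" j] c Suc by simp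
  qed
  then show ?thesis by (simp add: order_ge_def)
qed

text \<open>The expansion of \<open>F (v 0 + u, v 1 + w, v 2)\<close> with outer variable
  \<open>u\<close> and inner variable \<open>w\<close>; its coefficients are Hasse derivatives at
  \<open>v\<close>.\<close>

definition taylor :: "(3 \<Rightarrow> 'k::comm_ring_1) \<Rightarrow> (3, 'k) mpoly \<Rightarrow> 'k poly poly" where
  "taylor v = subst_mpoly (\<lambda>c. [:[:c:]:])
     (\<lambda>j. if j = 0 then [:[:v 0:], 1:] else if j = 1 then [:[:v 1, 1:]:] else [:[:v 2:]:])"

lemma coeff_hom_const: "coeff_hom (\<lambda>c. [:c:])"
  by unfold_locales (auto simp: one_pCons)

lemma coeff_hom_const2: "coeff_hom (\<lambda>c. [:[:c:]:])"
  by unfold_locales (auto simp: one_pCons)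

lemma coeff_hom_poly: "coeff_hom (\<lambda>p. poly p a)"
  by unfold_locales auto

lemma coeff_hom_pcompose: "coeff_hom (\<lambda>p. pcompose p q)"
  by unfold_locales (auto simp: pcompose_add pcompose_mult pcompose_1)

interpretation taylor: coeff_hom "taylor v" for v
  unfolding taylor_def by (rule coeff_hom_subst[OF coeff_hom_const2])

lemma const_poly_power: "[:p:] ^ k = [:p ^ k:]" for p :: "'a::comm_ring_1"
  by (induction k) (auto simp: one_pCons mult.commute)

lemma coeff_linear_poly_power': "coeff ([:a, 1:] ^ n) i = of_nat (n choose i) * a ^ (n - i)"
  for a :: "'a::comm_ring_1"
proof (cases "i \<le> n")
  case False
  have "degree ([:a, 1:] ^ n) \<le> n" using degree_power_le[of "[:a, 1:]" n] by simp
  then show ?thesis using False by (simp add: coeff_eq_0 binomial_eq_0)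
qed (simp add: coeff_linear_poly_power)

lemma coeff_taylor_single:
  "coeff (coeff (taylor v (sg m c)) i) j =
     c * (of_nat (lk m 0 choose i) * v 0 ^ (lk m 0 - i)) *
     (of_nat (lk m 1 choose j) * v 1 ^ (lk m 1 - j)) * v 2 ^ lk m 2"
proof -
  have of_nat: "(of_nat k :: 'a poly) = [:of_nat k:]" for k by (simp add: of_nat_poly)
  have "taylor v (sg m c) = [:[:c:]:] * ([:[:v 0:], 1:] ^ lk m 0 * [:[:v 1, 1:] ^ lk m 1:] * [:[:v 2 ^ lk m 2:]:])"
    by (simp add: taylor_def coeff_hom.subst_single[OF coeff_hom_const2] mono_val_UNIV prod_3'
        const_poly_power)
  also have "\<dots> = smult ([:c:] * [:v 1, 1:] ^ lk m 1 * [:v 2 ^ lk m 2:]) ([:[:v 0:], 1:] ^ lk m 0)"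
    by (simp add: mult_ac)
  finally have "coeff (taylor v (sg m c)) i
      = smult (c * v 2 ^ lk m 2 * (of_nat (lk m 0 choose i) * v 0 ^ (lk m 0 - i))) ([:v 1, 1:] ^ lk m 1)"
    by (simp add: coeff_linear_poly_power' const_poly_power of_nat mult_ac)
  then show ?thesis by (simp add: coeff_linear_poly_power' mult_ac)
qed

lemma eval_taylor: "eval_mpoly v F = coeff (coeff (taylor v F) 0) 0"
proof -
  have "poly (poly (taylor v F) 0) 0 = eval_mpoly v F"
    unfolding taylor_def eval_mpoly_subst subst_comp[OF coeff_hom_poly]
    by (rule arg_cong2[where f = "\<lambda>h x. subst_mpoly h x F"]; rule ext) (use cases_3 in auto)
  then show ?thesis by (simp add: poly_0_coeff_0)
qed

lemma order_ge_1_iff: "order_ge (Suc 0) (taylor v F) \<longleftrightarrow> eval_mpoly v F = 0"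
  by (simp add: order_ge_def eval_taylor)

section \<open>Splitting off lines\<close>

definition pt :: "'k \<Rightarrow> 'k \<Rightarrow> 3 \<Rightarrow> 'k::one" where
  "pt a b j = (if j = 0 then a else if j = 1 then b else 1)"

lemma pt_simps [simp]: "pt a b 0 = a" "pt a b 1 = b" "pt a b 2 = 1"
  by (auto simp: pt_def)

text \<open>Restriction to the line \<open>x = a * z\<close>, with the affine coordinate
  \<open>y / z\<close> as the polynomial variable.\<close>

definition on_line :: "'k::comm_ring_1 \<Rightarrow> (3, 'k) mpoly \<Rightarrow> 'k poly" where
  "on_line a = subst_mpoly (\<lambda>c. [:c:]) (\<lambda>j. if j = 0 then [:a:] else if j = 1 then [:0, 1:] else 1)"

interpretation on_line: coeff_hom "on_line a" for a
  unfolding on_line_def by (rule coeff_hom_subst[OF coeff_hom_const])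

lemma on_line_sum:
  "on_line a F = (\<Sum>m\<in>ks F. monom (lk F m * a ^ lk m 0) (lk m 1))"
  unfolding on_line_def subst_mpoly_def
  by (rule sum.cong) (auto simp: mono_val_UNIV prod_3' const_poly_power monom_altdef mult.commute)

lemma coeff_on_line:
  "coeff (on_line a F) j = (\<Sum>m | m \<in> ks F \<and> lk m 1 = j. lk F m * a ^ lk m 0)"
  by (simp add: on_line_sum coeff_sum sum.If_cases[symmetric] sum.inter_filter[symmetric])

lemma degree_on_line: "is_form d F \<Longrightarrow> degree (on_line a F) \<le> d"
  unfolding on_line_sum
  by (intro degree_sum_le) (auto simp: is_form_iff tdeg_3 intro!: order.trans[OF degree_monom_le])

lemma poly_on_line: "poly (on_line a F) b = eval_mpoly (pt a b) F"
  unfolding on_line_def eval_mpoly_subst subst_comp[OF coeff_hom_poly]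
  by (rule arg_cong2[where f = "\<lambda>h x. subst_mpoly h x F"]; rule ext) (auto simp: pt_def)

lemma taylor_on_line: "coeff (taylor (pt a b) F) 0 = pcompose (on_line a F) [:b, 1:]"
proof -
  have "poly (taylor (pt a b) F) 0 = pcompose (on_line a F) [:b, 1:]"
    unfolding taylor_def on_line_def subst_comp[OF coeff_hom_poly] subst_comp[OF coeff_hom_pcompose]
    by (rule arg_cong2[where f = "\<lambda>h x. subst_mpoly h x F"]; rule ext)
      (use cases_3 in \<open>auto simp: one_pCons pcompose_pCons\<close>)
  then show ?thesis by (simp add: poly_0_coeff_0)
qed

lemma order_ge_on_line:
  fixes F :: "(3, 'k::field) mpoly"
  assumes "order_ge m (taylor (pt a b) F)"
  shows "[:- b, 1:] ^ m dvd on_line a F"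
proof -
  have "coeff (pcompose (on_line a F) [:b, 1:]) j = 0" if "j < m" for j
    using assms that by (simp add: order_ge_def taylor_on_line[symmetric])
  then have "monom 1 m dvd pcompose (on_line a F) [:b, 1:]"
    by (simp add: monom_1_dvd_iff')
  then obtain s where s: "pcompose (on_line a F) [:b, 1:] = monom 1 m * s" by (auto simp: dvd_def)
  have "on_line a F = pcompose (pcompose (on_line a F) [:b, 1:]) [:- b, 1:]"
    by (simp add: pcompose_assoc[symmetric] pcompose_pCons)
  also have "\<dots> = [:- b, 1:] ^ m * pcompose s [:- b, 1:]"
    unfolding s
    by (simp add: pcompose_mult monom_altdef coeff_hom.hom_power[OF coeff_hom_pcompose] pcompose_pCons)
  finally show ?thesis by simp
qed

definition line :: "'k::comm_ring_1 \<Rightarrow> (3, 'k) mpoly" where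
  "line a = X 0 - scal a * X 2"

text \<open>Division by the linear form \<open>x - a * z\<close>: occurrences of \<open>x\<close>
  are traded for \<open>a * z\<close>, so the remainder is free of \<open>x\<close>.\<close>

lemma form_mod_line:
  fixes F :: "(3, 'k::comm_ring_1) mpoly"
  assumes "is_form d F"
  shows "\<exists>G H. F = line a * G + H \<and> is_form (d - 1) G \<and> (d = 0 \<longrightarrow> G = 0) \<and>
    is_form d H \<and> (\<forall>m\<in>ks H. lk m 0 = 0)"
  using assms
proof (induction d arbitrary: F)
  case 0
  obtain A B where "F = A + X 0 * B" "is_form 0 A" "\<forall>m\<in>ks A. lk m 0 = 0" "B = 0"
    using split_var[OF 0, of 0] by metis
  then show ?case by (intro exI[of _ 0] exI[of _ A]) auto
next
  case (Suc d)
  obtain A B where F: "F = A + X 0 * B" "is_form (Suc d) A" "\<forall>m\<in>ks A. lk m 0 = 0" "is_form d B"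
    using split_var[OF Suc.prems, of 0] by (metis diff_Suc_1)
  obtain G H where B: "B = line a * G + H" "is_form (d - 1) G" "d = 0 \<longrightarrow> G = 0" "is_form d H"
    "\<forall>m\<in>ks H. lk m 0 = 0"
    using Suc.IH[OF F(4)] by blast
  have "F = A + line a * B + scal a * X 2 * B" unfolding F(1) line_def by (simp add: algebra_simps)
  also have "\<dots> = A + line a * B + scal a * X 2 * (line a * G + H)" by (simp flip: B(1))
  also have "\<dots> = line a * (B + scal a * (X 2 * G)) + (A + scal a * (X 2 * H))"
    by (simp add: algebra_simps)
  finally have "F = line a * (B + scal a * (X 2 * G)) + (A + scal a * (X 2 * H))" .
  moreover have "is_form d (B + scal a * (X 2 * G))"
    using B F(4) is_form_X_mult[OF B(2), of 2]
    by (cases "d = 0") (auto intro!: is_form_add is_form_scal_mult)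
  moreover have "is_form (Suc d) (A + scal a * (X 2 * H))"
    using F B by (intro is_form_add is_form_scal_mult is_form_X_mult)
  moreover have "\<forall>m\<in>ks (A + scal a * (X 2 * H)). lk m 0 = 0"
  proof
    fix m assume m: "m \<in> ks (A + scal a * (X 2 * H))"
    have "ks (scal a * (X 2 * H)) \<subseteq> ks (X 2 * H)"
      using keys_mult[of "scal a" "X 2 * H"] by (auto simp: scal_def split: if_splits)
    then have "m \<in> ks A \<or> m \<in> ks (X 2 * H)"
      using m keys_add[of A "scal a * (X 2 * H)"] by blast
    then show "lk m 0 = 0"
      using F(3) B(5) by (auto simp: keys_X_mult lookup_add lookup_single)
  qed
  ultimately show ?case
    by (intro exI[of _ "B + scal a * (X 2 * G)"] exI[of _ "A + scal a * (X 2 * H)"]) auto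
qed

lemma line_dvd:
  fixes F :: "(3, 'k::comm_ring_1) mpoly"
  assumes "is_form d F" "on_line a F = 0"
  shows "\<exists>G. F = line a * G \<and> is_form (d - 1) G \<and> (d = 0 \<longrightarrow> G = 0)"
proof -
  obtain G H where G: "F = line a * G + H" "is_form (d - 1) G" "d = 0 \<longrightarrow> G = 0"
    and H: "is_form d H" "\<forall>m\<in>ks H. lk m 0 = 0"
    using form_mod_line[OF assms(1)] by blast
  have "on_line a (line a) = 0"
    unfolding line_def on_line.hom_diff on_line.hom_mult
    by (simp add: on_line_def subst_X[OF coeff_hom_const] subst_scal[OF coeff_hom_const])
  then have "on_line a H = 0"
    using assms(2) unfolding G(1) on_line.hom_add on_line.hom_mult by simp
  have "lk H m = 0" if m: "m \<in> ks H" for m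
  proof -
    \<comment> \<open>In a form in \<open>y\<close> and \<open>z\<close> alone the exponent of
      \<open>y\<close> determines the monomial, so the restriction to the line loses no
      coefficient.\<close>
    have "{k. k \<in> ks H \<and> lk k 1 = lk m 1} = {m}"
    proof (safe)
      fix k assume k: "k \<in> ks H" "lk k 1 = lk m 1"
      then have "lk k 2 = lk m 2" using H m unfolding is_form_iff tdeg_3
        by (metis add_left_cancel)
      then have "lk k j = lk m j" for j
        using H m k cases_3[of j] by auto
      then show "k = m" by (rule poly_mapping_eqI)
    qed (use m in auto)
    then have "coeff (on_line a H) (lk m 1) = lk H m * a ^ lk m 0"
      by (simp add: coeff_on_line)
    then show ?thesis using \<open>on_line a H = 0\<close> H(2) m by simp
  qed
  then have "H = 0" by (metis in_keys_iff poly_mapping_eqI lookup_zero)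
  then show ?thesis using G by auto
qed

text \<open>Bezout for a line: the restriction has degree at most \<open>d\<close> but a root of
  multiplicity at least \<open>m\<close> at every element of \<open>B\<close>, so it is zero and the
  line divides \<open>F\<close>.\<close>

lemma peel:
  fixes F :: "(3, 'k::field) mpoly"
  assumes F: "is_form d F" and fin: "finite B" and order_ge: "\<And>b. b \<in> B \<Longrightarrow> order_ge m (taylor (pt a b) F)"
    and card: "d < card B * m"
  shows "\<exists>G. F = line a * G \<and> is_form (d - 1) G \<and> (d = 0 \<longrightarrow> G = 0)"
proof (rule line_dvd[OF F], rule ccontr)
  assume nz: "on_line a F \<noteq> 0"
  have ord: "m \<le> order b (on_line a F)" if "b \<in> B" for b
    using order_ge_on_line[OF order_ge[OF that]] nz by (simp add: order_divides)
  have m: "m > 0" using card by (cases m) auto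
  have sub: "B \<subseteq> {b. poly (on_line a F) b = 0}"
    using ord m nz by (force simp: order_root)
  have "card B * m \<le> (\<Sum>b\<in>B. order b (on_line a F))"
    using sum_bounded_below[of B m "\<lambda>b. order b (on_line a F)"] ord by simp
  also have "\<dots> \<le> (\<Sum>b | poly (on_line a F) b = 0. order b (on_line a F))"
    by (rule sum_mono2) (use sub poly_roots_finite[OF nz] in auto)
  also have "\<dots> \<le> degree (on_line a F)" using sum_order_le_degree[OF nz] .
  also have "\<dots> \<le> d" using degree_on_line[OF F] .
  finally show False using card by simp
qed

lemma taylor_line: "taylor (pt a' b') (line a) = [:[:a' - a:], 1:]"
  unfolding line_def taylor.hom_diff taylor.hom_mult
  by (simp add: taylor_def subst_X[OF coeff_hom_const2] subst_scal[OF coeff_hom_const2])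

lemma order_ge_line_same: "order_ge m (taylor (pt a b) (line a * G)) \<Longrightarrow> order_ge (m - 1) (taylor (pt a b) G)"
  by (cases m) (auto simp: taylor.hom_mult taylor_line intro: order_ge_u_mult)

lemma order_ge_line_other:
  fixes G :: "(3, 'k::field) mpoly"
  shows "order_ge m (taylor (pt a' b) (line a * G)) \<Longrightarrow> a \<noteq> a' \<Longrightarrow> order_ge m (taylor (pt a' b) G)"
  unfolding taylor.hom_mult taylor_line by (erule order_ge_unit_mult) auto

text \<open>\<open>n i\<close> points lie on the \<open>i\<close>-th line, where a form of degree less than \<open>D\<close> vanishes to order
  \<open>m i\<close>; the lines in the list are split off one after the other until the degree is exhausted.\<close>

fun peels :: "(nat \<Rightarrow> nat) \<Rightarrow> (nat \<Rightarrow> nat) \<Rightarrow> nat \<Rightarrow> nat list \<Rightarrow> bool" where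
  "peels n m D [] \<longleftrightarrow> D = 0"
| "peels n m D (c # cs) \<longleftrightarrow> D \<le> n c * m c \<and> peels n (m(c := m c - 1)) (D - 1) cs"

text \<open>\<open>D\<close> is one more than the degree still left; the premise for
  \<open>D = 0\<close> lets this value stand for the zero form. Splitting off a line costs one order
  at its own points and none at the points of the other lines.\<close>

lemma peels_zero:
  fixes F :: "(3, 'k::field) mpoly"
  assumes "peels n m D cs" "set cs \<subseteq> {..<r}" "inj_on A {..<r}" "inj Y"
    and "D = 0 \<longrightarrow> F = 0" "is_form (D - 1) F"
    and "\<And>i j. i < r \<Longrightarrow> j < n i \<Longrightarrow> order_ge (m i) (taylor (pt (A i) (Y j)) F)"
  shows "F = 0"
  using assms
proof (induction cs arbitrary: m D F)
  case (Cons c cs)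
  show ?case
  proof (cases "D = 0")
    case False
    have c: "c < r" using Cons.prems by simp
    have "D \<le> n c * m c" using Cons.prems(1) by simp
    moreover have "card (Y ` {..<n c}) = n c"
      using Cons.prems(4) by (simp add: card_image inj_on_subset)
    ultimately have "D - 1 < card (Y ` {..<n c}) * m c" using False by simp
    moreover have "order_ge (m c) (taylor (pt (A c) b) F)" if "b \<in> Y ` {..<n c}" for b
      using Cons.prems(7)[OF c] that by auto
    ultimately obtain G where G: "F = line (A c) * G" "is_form (D - 1 - 1) G" "D - 1 = 0 \<longrightarrow> G = 0"
      using peel[OF Cons.prems(6) finite_imageI[OF finite_lessThan]] by metis
    have "G = 0"
    proof (rule Cons.IH[of "m(c := m c - 1)" "D - 1"])
      show "order_ge ((m(c := m c - 1)) i) (taylor (pt (A i) (Y j)) G)" if "i < r" "j < n i" for i j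
      proof (cases "i = c")
        case True
        then show ?thesis using Cons.prems(7)[OF that] G(1) order_ge_line_same by auto
      next
        case False
        then have "A c \<noteq> A i" using Cons.prems(3) c that by (auto simp: inj_on_def)
        then show ?thesis using Cons.prems(7)[OF that] False order_ge_line_other unfolding G(1) by auto
      qed
      show "peels n (m(c := m c - 1)) (D - 1) cs" using Cons.prems(1) by simp
      show "set cs \<subseteq> {..<r}" using Cons.prems(2) by simp
    qed (fact Cons.prems G)+
    then show ?thesis using G by simp
  qed (use Cons.prems in simp)
qed simp

lemma peels_mono: "peels n m D cs \<Longrightarrow> D' \<le> D \<Longrightarrow> peels n m D' cs"
proof (induction cs arbitrary: m D D')
  case (Cons c cs)
  from Cons.prems have 1: "peels n (m(c := m c - 1)) (D - 1) cs" by simp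
  have "peels n (m(c := m c - 1)) (D' - 1) cs"
    by (rule Cons.IH[OF 1]) (use Cons.prems in simp)
  then show ?case using Cons.prems by simp
qed simp

text \<open>One round takes the lines \<open>0, ..., j - 1\<close> in descending order, so that the
  bound has dropped to \<open>E + i + 1\<close> when line \<open>i\<close> is split off.\<close>

lemma peels_round:
  assumes "\<And>i. i < j \<Longrightarrow> E + i + 1 \<le> n i * m i"
    and "peels n (\<lambda>i. if i < j then m i - 1 else m i) E cs"
  shows "peels n m (E + j) (rev [0..<j] @ cs)"
  using assms
proof (induction j arbitrary: m)
  case (Suc j)
  have "(\<lambda>i. if i < j then (m(j := m j - 1)) i - 1 else (m(j := m j - 1)) i)
      = (\<lambda>i. if i < Suc j then m i - 1 else m i)"
    by (auto simp: less_Suc_eq)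
  then have "peels n (m(j := m j - 1)) (E + j) (rev [0..<j] @ cs)"
    using Suc.prems by (intro Suc.IH) auto
  then show ?case using Suc.prems(1)[of j] by simp
qed simp

section \<open>Configurations without curves of low degree with triple points\<close>

lemma infinite_alg_closed: "infinite (UNIV :: 'k::alg_closed_field set)"
proof
  assume fin: "finite (UNIV :: 'k set)"
  let ?p = "(\<Prod>a\<in>(UNIV :: 'k set). [:- a, 1:]) + 1"
  have root: "poly ?p x = 1" for x
    using fin by (simp add: poly_prod prod_zero_iff)
  have "card (UNIV :: 'k set) > 0" using fin by (simp add: card_gt_0_iff)
  moreover have "degree (\<Prod>a\<in>(UNIV :: 'k set). [:- a, 1:]) = card (UNIV :: 'k set)"
    by (subst degree_prod_eq_sum_degree) auto
  ultimately have "degree ?p > 0" by (simp add: degree_add_eq_left)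
  then obtain x where "poly ?p x = 0" using alg_closed_imp_poly_has_root by blast
  with root[of x] show False by simp
qed

definition kills :: "nat \<Rightarrow> ('k \<times> 'k::field) set \<Rightarrow> bool" where
  "kills d S \<longleftrightarrow> finite S \<and> S \<noteq> {} \<and>
     (\<forall>F. is_form d F \<and> (\<forall>(a, b)\<in>S. order_ge 3 (taylor (pt a b) F)) \<longrightarrow> F = 0)"

lemma peels_kills:
  assumes inf: "infinite (UNIV :: 'k::field set)"
    and peels: "peels n (\<lambda>_. 3) (Suc d) cs" and cs: "set cs \<subseteq> {..<r}"
  shows "\<exists>S :: ('k \<times> 'k) set. kills d S \<and> card S = sum n {..<r}"
proof -
  obtain A :: "nat \<Rightarrow> 'k" where A: "inj A"
    using infinite_countable_subset[OF inf] by auto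
  define C where "C = (SIGMA i:{..<r}. {..<n i})"
  define S where "S = (\<lambda>(i, j). (A i, A j)) ` C"
  obtain c cs' where c: "cs = c # cs'" using peels by (cases cs) auto
  have "c < r" "n c > 0" using peels cs c by (auto intro: Nat.gr0I)
  then have "C \<noteq> {}" by (auto simp: C_def)
  moreover have "finite C" by (simp add: C_def)
  moreover have "card S = sum n {..<r}"
    unfolding S_def by (subst card_image) (use A in \<open>auto simp: C_def inj_on_def\<close>)
  moreover have "F = 0" if F: "is_form d F" "\<forall>(a, b)\<in>S. order_ge 3 (taylor (pt a b) F)" for F
    by (rule peels_zero[OF peels cs _ A])
      (use F inj_on_subset[OF A] in \<open>auto simp: S_def C_def\<close>)
  ultimately have "kills d S \<and> card S = sum n {..<r}" by (auto simp: kills_def S_def)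
  then show ?thesis by blast
qed

text \<open>The first round asks for \<open>2 * a + i + 1 \<le> 3 * n i\<close>, and the chosen
  number of points is the least one with this property. For \<open>i < a\<close> it implies the
  conditions \<open>a + i + 1 \<le> 2 * n i\<close> and \<open>i + 1 \<le> n i\<close> of the other
  rounds.\<close>

lemma peels_three_rounds:
  assumes a: "2 * t + 2 \<le> 3 * a"
  shows "peels (\<lambda>i. 1 + (2 * a + i) div 3) (\<lambda>_. 3) (2 * t + 2)
    (rev [0..<a] @ rev [0..<a] @ rev [0..<a] @ [])"
proof (rule peels_mono[OF _ a])
  let ?n = "\<lambda>i. 1 + (2 * a + i) div 3"
  have n: "2 * a + i + 1 \<le> 3 * ?n i" for i by presburger
  have "peels ?n (\<lambda>i. if i < a then 2 else 3) (a + a)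
    (rev [0..<a] @ rev [0..<a] @ [])"
  proof (rule peels_round)
    show "a + i + 1 \<le> ?n i * (if i < a then 2 else 3)" if "i < a" for i
      using n[of i] that by simp
    show "peels ?n (\<lambda>i. if i < a then (if i < a then 2 else 3) - 1 else (if i < a then 2 else 3)) a
      (rev [0..<a] @ [])"
    proof (subst add_0[symmetric], rule peels_round)
      show "0 + i + 1 \<le> ?n i * (if i < a then (if i < a then 2 else 3) - 1 else (if i < a then 2 else 3))"
        if "i < a" for i
        using n[of i] that by simp
    qed simp
  qed
  moreover have "(\<lambda>i. if i < a then 3 - 1 else 3) = (\<lambda>i. if i < a then 2 else 3 :: nat)" by auto
  ultimately have "peels ?n (\<lambda>i. if i < a then 3 - 1 else 3) (2 * a) (rev [0..<a] @ rev [0..<a] @ [])"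
    by (simp only: mult_2)
  then have "peels ?n (\<lambda>_. 3) (2 * a + a) (rev [0..<a] @ rev [0..<a] @ rev [0..<a] @ [])"
    by (rule peels_round[rotated]) (use n in \<open>simp add: mult.commute\<close>)
  then show "peels ?n (\<lambda>_. 3) (3 * a) (rev [0..<a] @ rev [0..<a] @ rev [0..<a] @ [])" by simp
qed

text \<open>With \<open>a\<close> about \<open>2 * t / 3\<close> the count is about
  \<open>10 / 27 * t\<^sup>2\<close>, below the available \<open>t\<^sup>2 / 2\<close>; hence three
  rounds suffice for large \<open>t\<close>.\<close>

lemma sum_three_rounds: "6 * (\<Sum>i<a. 1 + (2 * a + i) div 3) \<le> 5 * a * (a + 1)" for a :: nat
proof -
  have "6 * (\<Sum>i<a. 1 + (2 * a + i) div 3) = (\<Sum>i<a. 6 * (1 + (2 * a + i) div 3))"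
    by (simp add: sum_distrib_left)
  also have "\<dots> \<le> (\<Sum>i<a. (4 * a + 6) + 2 * i)" by (rule sum_mono) presburger
  also have "\<dots> = (\<Sum>i<a. 4 * a + 6) + 2 * (\<Sum>i<a. i)"
    by (simp only: sum.distrib sum_distrib_left)
  also have "2 * (\<Sum>i<a. i) = a * (a - 1)"
  proof (induction a)
    case (Suc a)
    then show ?case by (cases a) auto
  qed simp
  also have "(\<Sum>i<a. 4 * a + 6) + a * (a - 1) = 5 * a * (a + 1)"
    by (cases a) (auto simp: algebra_simps)
  finally show ?thesis .
qed

text \<open>Splitting off \<open>x = z\<close> and \<open>x = s * z\<close> twice each lowers the
  degree from 7 to 3 and keeps the triple point at \<open>(0 : 0 : 1)\<close>, so the remaining
  cubic is a form in \<open>x\<close> and \<open>y\<close>. On \<open>x = z\<close> it has the zeros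
  \<open>0\<close>, \<open>1\<close>, \<open>r\<close> and, projecting \<open>(s, 1)\<close> from
  the vertex, \<open>inverse s\<close>; the assumptions on \<open>r\<close> and \<open>s\<close>
  make these distinct.\<close>

lemma kills_cubic_cone:
  fixes s r :: "'k::field"
  assumes s: "s \<noteq> 0" "s \<noteq> 1" and r: "r \<noteq> 0" "r \<noteq> 1" "r * s \<noteq> 1"
  shows "kills 7 (insert (0, 0) ({1, s} \<times> {0, 1, r}))"
  unfolding kills_def
proof (intro conjI allI impI)
  fix F :: "(3, 'k) mpoly"
  assume F: "is_form 7 F \<and> (\<forall>(a, b)\<in>insert (0, 0) ({1, s} \<times> {0, 1, r}). order_ge 3 (taylor (pt a b) F))"
  let ?B = "{0, 1, r}"
  have B: "card ?B = 3" "finite ?B" using r by auto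
  obtain G1 where G1: "F = line 1 * G1" "is_form 6 G1"
    using peel[of 7 F ?B 3 1] F B by auto
  have l1: "order_ge 2 (taylor (pt 1 b) G1)" "order_ge 3 (taylor (pt s b) G1)" if "b \<in> ?B" for b
    using order_ge_line_same[of 3 1 b G1] order_ge_line_other[of 3 s b 1 G1] F G1(1) s that by auto
  have o1: "order_ge 3 (taylor (pt 0 0) G1)"
    using order_ge_line_other[of 3 0 0 1 G1] F G1(1) by auto
  obtain G2 where G2: "G1 = line s * G2" "is_form 5 G2"
    using peel[of 6 G1 ?B 3 s] G1 l1 B by auto
  have l2: "order_ge 2 (taylor (pt 1 b) G2)" "order_ge 2 (taylor (pt s b) G2)" if "b \<in> ?B" for b
    using order_ge_line_same[of 3 s b G2] order_ge_line_other[of 2 1 b s G2] l1[OF that] G2(1) s by auto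
  have o2: "order_ge 3 (taylor (pt 0 0) G2)"
    using order_ge_line_other[of 3 0 0 s G2] o1 G2(1) s by auto
  obtain G3 where G3: "G2 = line 1 * G3" "is_form 4 G3"
    using peel[of 5 G2 ?B 2 1] G2 l2 B by auto
  have l3: "order_ge 1 (taylor (pt 1 b) G3)" "order_ge 2 (taylor (pt s b) G3)" if "b \<in> ?B" for b
    using order_ge_line_same[of 2 1 b G3] order_ge_line_other[of 2 s b 1 G3] l2[OF that] G3(1) s by auto
  have o3: "order_ge 3 (taylor (pt 0 0) G3)"
    using order_ge_line_other[of 3 0 0 1 G3] o2 G3(1) by auto
  obtain G where G: "G3 = line s * G" "is_form 3 G"
    using peel[of 4 G3 ?B 2 s] G3 l3 B by auto
  have l: "order_ge 1 (taylor (pt 1 b) G)" "order_ge 1 (taylor (pt s b) G)" if "b \<in> ?B" for b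
    using order_ge_line_same[of 2 s b G] order_ge_line_other[of 1 1 b s G] l3[OF that] G(1) s by auto
  have o: "order_ge 3 (taylor (pt 0 0) G)"
    using order_ge_line_other[of 3 0 0 s G] o3 G(1) s by auto
  have coeff: "coeff (coeff (taylor (pt 0 0) G) i) j = (\<Sum>m | m \<in> ks G \<and> lk m 0 = i \<and> lk m 1 = j. lk G m)" for i j
  proof -
    have z: "of_nat (k choose i) * (0::'k) ^ (k - i) = (if k = i then 1 else 0)" for k i :: nat
      by (cases "k < i") (auto simp: zero_power_eq binomial_eq_0)
    have "coeff (coeff (taylor (pt 0 0) G) i) j
      = (\<Sum>m\<in>ks G. if lk m 0 = i \<and> lk m 1 = j then lk G m else 0)"
      by (subst poly_mapping_decomp[of G], subst taylor.hom_sum)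
        (auto simp: coeff_sum coeff_taylor_single z intro!: sum.cong)
    then show ?thesis by (simp add: sum.inter_filter)
  qed
  \<comment> \<open>A monomial of the cubic that contains \<open>z\<close> has degree less than 3 in
    \<open>x\<close> and \<open>y\<close>, so its coefficient is one of the Taylor coefficients that
    vanish at the vertex.\<close>
  have m2: "lk m 2 = 0" if m: "m \<in> ks G" for m
  proof (rule ccontr)
    assume "lk m 2 \<noteq> 0"
    have "{k. k \<in> ks G \<and> lk k 0 = lk m 0 \<and> lk k 1 = lk m 1} = {m}"
    proof safe
      fix k assume k: "k \<in> ks G" "lk k 0 = lk m 0" "lk k 1 = lk m 1"
      then have "lk k 2 = lk m 2" using G(2) m unfolding is_form_iff tdeg_3
        by (metis add_left_cancel)
      then show "k = m" using k by (intro poly_mapping_eqI_3)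
    qed (use m in auto)
    then have "coeff (coeff (taylor (pt 0 0) G) (lk m 0)) (lk m 1) = lk G m"
      by (simp add: coeff)
    moreover have "lk m 0 + lk m 1 < 3"
      using \<open>lk m 2 \<noteq> 0\<close> G(2) m unfolding is_form_iff tdeg_3 by force
    ultimately show False using o m by (simp add: order_ge_def in_keys_iff)
  qed
  have deg: "lk m 0 = 3 - lk m 1" "lk m 1 \<le> 3" if "m \<in> ks G" for m
    using G(2) m2[OF that] that unfolding is_form_iff tdeg_3 by force+
  have ev: "eval_mpoly (pt a b) G = (\<Sum>m\<in>ks G. lk G m * (a ^ lk m 0 * b ^ lk m 1))" for a b
    using m2 by (simp add: eval_mpoly_subst subst_mpoly_def mono_val_UNIV prod_3' mult.assoc)
  have cone: "eval_mpoly (pt s 1) G = s ^ 3 * eval_mpoly (pt 1 (inverse s)) G"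
    unfolding ev sum_distrib_left
  proof (rule sum.cong)
    fix m assume "m \<in> ks G"
    from deg[OF this] have "s ^ 3 = s ^ lk m 0 * s ^ lk m 1"
      by (simp flip: power_add)
    then show "lk G m * (s ^ lk m 0 * 1 ^ lk m 1) = s ^ 3 * (lk G m * (1 ^ lk m 0 * inverse s ^ lk m 1))"
      using s by (simp add: power_inverse field_simps)
  qed simp
  have "on_line 1 G = 0"
  proof (rule ccontr)
    assume nz: "on_line 1 G \<noteq> 0"
    have "{0, 1, r, inverse s} \<subseteq> {x. poly (on_line 1 G) x = 0}"
      using l cone s by (auto simp: poly_on_line order_ge_1_iff)
    then have "card {0, 1, r, inverse s} \<le> card {x. poly (on_line 1 G) x = 0}"
      using poly_roots_finite[OF nz] by (intro card_mono)
    also have "\<dots> \<le> degree (on_line 1 G)" using card_poly_roots_bound[OF nz] .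
    also have "\<dots> \<le> 3" using degree_on_line[OF G(2)] .
    finally have "card {0, 1, r, inverse s} \<le> 3" .
    moreover have "r \<noteq> inverse s" "inverse s \<noteq> 1" using r s by (auto simp: field_simps)
    ultimately show False using s r by (auto simp: card_insert_if split: if_splits)
  qed
  have "lk G m = 0" if m: "m \<in> ks G" for m
  proof -
    have "{k. k \<in> ks G \<and> lk k 1 = lk m 1} = {m}"
    proof safe
      fix k assume k: "k \<in> ks G" "lk k 1 = lk m 1"
      then have "lk k 0 = lk m 0" "lk k 2 = lk m 2" using deg m2 m by auto
      then show "k = m" using k by (intro poly_mapping_eqI_3)
    qed (use m in auto)
    then have "coeff (on_line 1 G) (lk m 1) = lk G m" by (simp add: coeff_on_line)
    then show ?thesis using \<open>on_line 1 G = 0\<close> by simp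
  qed
  then have "G = 0" by (metis in_keys_iff poly_mapping_eqI lookup_zero)
  then show "F = 0" using G1 G2 G3 G by simp
qed auto

lemma kills_7:
  assumes inf: "infinite (UNIV :: 'k::field set)"
  shows "\<exists>S :: ('k \<times> 'k) set. kills 7 S \<and> card S \<le> 7"
proof -
  obtain s :: 'k where s: "s \<noteq> 0" "s \<noteq> 1"
    using ex_new_if_finite[OF inf, of "{0, 1}"] by auto
  obtain r :: 'k where "r \<noteq> 0" "r \<noteq> 1" "r \<noteq> inverse s"
    using ex_new_if_finite[OF inf, of "{0, 1, inverse s}"] by auto
  then have r: "r \<noteq> 0" "r \<noteq> 1" "r * s \<noteq> 1"
    using s by (auto simp: field_simps)
  have "card ({1, s} \<times> {0, 1, r}) = 6"
    using s r by (simp add: card_cartesian_product)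
  then have "card (insert (0, 0) ({1, s} \<times> {0, 1, r})) \<le> 7"
    using card_insert_le_m1[of 7 "{1, s} \<times> {0, 1, r}" "(0, 0)"] by simp
  then show ?thesis using kills_cubic_cone[OF s r] by blast
qed

lemma kills_list:
  assumes inf: "infinite (UNIV :: 'k::field set)"
    and "peels (\<lambda>i. ns ! i) (\<lambda>_. 3) (Suc d) cs" "set cs \<subseteq> {..<length ns}"
  shows "\<exists>S :: ('k \<times> 'k) set. kills d S \<and> card S = sum_list ns"
  using peels_kills[OF assms] by (simp add: sum_list_sum_nth atLeast0LessThan)

lemma kills_exists:
  assumes inf: "infinite (UNIV :: 'k::field set)"
    and n: "n \<noteq> 2" "t * (t + 1) div 2 + 1 \<le> n"
  shows "\<exists>S :: ('k \<times> 'k) set. kills (2 * t + 1) S \<and> card S \<le> n"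
proof -
  \<comment> \<open>The least number of lines for which three rounds exhaust the degree
    \<open>2 * t + 1\<close>.\<close>
  define a where "a = (2 * t + 4) div 3"
  have a: "2 * t + 2 \<le> 3 * a" "3 * a \<le> 2 * t + 4" unfolding a_def by linarith+
  have "peels (\<lambda>i. 1 + (2 * a + i) div 3) (\<lambda>_. 3) (Suc (2 * t + 1)) (rev [0..<a] @ rev [0..<a] @ rev [0..<a] @ [])"
    using peels_three_rounds[OF a(1)] by simp
  from peels_kills[OF inf this, of a]
  have main: ?thesis if "(\<Sum>i<a. 1 + (2 * a + i) div 3) \<le> t * (t + 1) div 2 + 1"
    using that n by force
  have list: ?thesis if "peels (\<lambda>i. ns ! i) (\<lambda>_. 3) (Suc (2 * t + 1)) cs" "set cs \<subseteq> {..<length ns}"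
    "sum_list ns \<le> n" for ns cs
    using kills_list[OF inf that(1,2)] that(3) by force
  \<comment> \<open>From \<open>t = 13\<close> on, \<open>83 * t + 86 \<le> 7 * t\<^sup>2\<close>
    holds, which makes the general estimate of the three-round count sufficient. In the last case
    the exact count is small enough. For the remaining values it is too large, for instance 15
    instead of 11 when \<open>t = 4\<close>.\<close>
  consider "t \<ge> 13" | "t = 1" | "t = 3" | "t = 4" | "t = 6" | "t = 7" | "t = 10"
    | "t \<in> {0, 2, 5, 8, 9, 11, 12}"
  proof -
    have "t \<ge> 13 \<or> t \<in> {..<13}" by auto
    then show thesis using that by (auto simp: lessThan_nat_numeral numeral_eq_Suc lessThan_Suc)
  qed
  then show ?thesis
  proof cases
    case 1
    show ?thesis
    proof (rule main)
      have "9 * (5 * a * (a + 1)) = 5 * (3 * a) * (3 * a + 3)" by (simp add: algebra_simps)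
      also have "\<dots> \<le> 5 * (2 * t + 4) * (2 * t + 7)" using a by (intro mult_mono) auto
      also have "\<dots> \<le> 27 * (t * (t + 1)) + 54"
      proof -
        obtain u where "t = u + 13" using 1 by (metis le_add_diff_inverse2)
        then show ?thesis by (simp add: algebra_simps)
      qed
      finally have "9 * (6 * (\<Sum>i<a. 1 + (2 * a + i) div 3)) \<le> 27 * (t * (t + 1)) + 54"
        using sum_three_rounds[of a] by linarith
      then show "(\<Sum>i<a. 1 + (2 * a + i) div 3) \<le> t * (t + 1) div 2 + 1" by linarith
    qed
  next
    case 2
    then have "3 \<le> n" using n by simp
    \<comment> \<open>The first list holds the numbers of points on the lines, the second the order
      of splitting, of length \<open>2 * t + 2\<close>. The later cases use the same format.\<close>
    then show ?thesis using 2 by (intro list[of "[2, 1]" "[0, 0, 1, 0]"]) (auto simp: numeral_eq_Suc)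
  next
    case 3
    then show ?thesis using kills_7[OF inf] n by auto
  next
    case 4
    then have "11 \<le> n" using n(2) by simp
    then show ?thesis using 4
      by (intro list[of "[4, 3, 3, 1]" "[0, 1, 2, 0, 1, 2, 0, 1, 2, 3]"]) (auto simp: numeral_eq_Suc)
  next
    case 5
    then have "22 \<le> n" using n(2) by simp
    then show ?thesis using 5
      by (intro list[of "[5, 5, 4, 4, 2]" "[0, 1, 2, 3, 0, 1, 2, 3, 4, 0, 1, 2, 3, 4]"]) (auto simp: numeral_eq_Suc)
  next
    case 6
    then have "29 \<le> n" using n(2) by simp
    then show ?thesis using 6
      by (intro list[of "[6, 6, 5, 5, 3, 3]" "[0, 1, 2, 3, 0, 1, 2, 3, 4, 5, 0, 1, 4, 5, 2, 3]"])
        (auto simp: numeral_eq_Suc)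
  next
    case 7
    then have "56 \<le> n" using n(2) by simp
    then show ?thesis using 7
      by (intro list[of "[8, 8, 7, 7, 6, 6, 4, 3]"
            "[0, 1, 2, 3, 4, 5, 0, 1, 2, 3, 4, 5, 6, 7, 0, 1, 6, 2, 3, 4, 5, 7]"])
        (auto simp: numeral_eq_Suc)
  next
    case 8
    show ?thesis
      by (rule main) (use 8 in \<open>auto simp: a_def lessThan_nat_numeral\<close>)
  qed
qed

section \<open>Genericity\<close>

text \<open>The multidegree is carried explicitly, since differences of multihomogeneous polynomials
  are under control only when the degrees agree.\<close>

definition multideg :: "nat \<Rightarrow> (nat \<Rightarrow> nat) \<Rightarrow> (nat \<times> 3, 'k::zero) mpoly \<Rightarrow> bool" where
  "multideg n d F \<longleftrightarrow> (\<forall>m\<in>ks F. ks m \<subseteq> {..<n} \<times> UNIV \<and> (\<forall>i<n. (\<Sum>j\<in>UNIV. lk m (i, j)) = d i))"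

lemma is_multiform_iff: "is_multiform n F \<longleftrightarrow> (\<exists>d. multideg n d F)"
  by (simp add: is_multiform_def multideg_def)

lemma multideg_mult:
  assumes "multideg n d F" "multideg n d' G"
  shows "multideg n (\<lambda>i. d i + d' i) (F * G)"
  unfolding multideg_def
proof
  fix m assume "m \<in> ks (F * G)"
  then obtain a b where ab: "m = a + b" "a \<in> ks F" "b \<in> ks G" using keys_mult[of F G] by blast
  then show "ks m \<subseteq> {..<n} \<times> UNIV \<and> (\<forall>i<n. (\<Sum>j\<in>UNIV. lk m (i, j)) = d i + d' i)"
    using assms keys_add[of a b] unfolding multideg_def ab(1)
    by (fastforce simp: lookup_add sum.distrib)
qed

lemma multideg_diff: "multideg n d F \<Longrightarrow> multideg n d G \<Longrightarrow> multideg n d (F - G)"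
  for F :: "(nat \<times> 3, 'k::ab_group_add) mpoly"
  using keys_diff[of F G] unfolding multideg_def by blast

lemma multideg_const: "multideg n (\<lambda>_. 0) (sg 0 c)"
  by (auto simp: multideg_def)

lemma multideg_single:
  assumes "i < n"
  shows "multideg n (\<lambda>k. if k = i then a + b + c else 0) (sg (sg (i, 0) a + sg (i, 1) b + sg (i, 2) c) u)"
proof -
  let ?m = "sg (i, 0 :: 3) a + sg (i, 1) b + sg (i, 2) c"
  have "ks ?m \<subseteq> {i} \<times> UNIV"
    using keys_add[of "sg (i, 0 :: 3) a + sg (i, 1) b" "sg (i, 2) c"]
      keys_add[of "sg (i, 0 :: 3) a" "sg (i, 1) b"]
    by (auto split: if_splits dest!: subsetD)
  then show ?thesis using assms
    by (auto simp: multideg_def sum_3' lookup_add lookup_single when_def)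
qed

lemma is_multiform_mult: "is_multiform n F \<Longrightarrow> is_multiform n G \<Longrightarrow> is_multiform n (F * G)"
  unfolding is_multiform_iff using multideg_mult by blast

lemma is_multiform_one: "is_multiform n (1 :: (nat \<times> 3, 'k::comm_ring_1) mpoly)"
  unfolding is_multiform_iff using multideg_const[of n "1 :: 'k"] by (simp only: single_one) blast

lemma multideg_X: "i < n \<Longrightarrow> multideg n (\<lambda>k. if k = i then 1 else 0) (X (i, j))"
  using multideg_single[of i n 1 0 0 1] multideg_single[of i n 0 1 0 1]
    multideg_single[of i n 0 0 1 1] cases_3[of j]
  by (auto simp: X_def cong: if_cong)

lemma is_multiform_X: "i < n \<Longrightarrow> is_multiform n (X (i, j))"
  unfolding is_multiform_iff using multideg_X by blast

lemma is_multiform_prod: "(\<And>a. a \<in> A \<Longrightarrow> is_multiform n (f a)) \<Longrightarrow> is_multiform n (prod f A)"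
  for f :: "'a \<Rightarrow> (nat \<times> 3, 'k::comm_ring_1) mpoly"
  by (induction A rule: infinite_finite_induct) (auto simp: is_multiform_one is_multiform_mult)

abbreviation ev :: "(nat \<Rightarrow> 3 \<Rightarrow> 'k) \<Rightarrow> (nat \<times> 3, 'k::comm_ring_1) mpoly \<Rightarrow> 'k" where
  "ev x \<equiv> eval_mpoly (\<lambda>(i, j). x i j)"

section \<open>Openness of full column rank by elimination\<close>

definition triv_kernel :: "'r set \<Rightarrow> 'c set \<Rightarrow> ('r \<Rightarrow> 'c \<Rightarrow> 'k::field) \<Rightarrow> bool" where
  "triv_kernel R C M \<longleftrightarrow>
    (\<forall>w. (\<forall>r\<in>R. (\<Sum>c\<in>C. M r c * w c) = 0) \<longrightarrow> (\<forall>c\<in>C. w c = 0))"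

text \<open>A Gauss step without division, which keeps polynomial entries polynomial; column
  \<open>c0\<close> is cleared and the pivot row \<open>r0\<close> becomes zero.\<close>

definition elim :: "'r \<Rightarrow> 'c \<Rightarrow> ('r \<Rightarrow> 'c \<Rightarrow> 'a::comm_ring_1) \<Rightarrow> 'r \<Rightarrow> 'c \<Rightarrow> 'a" where
  "elim r0 c0 M r c = M r0 c0 * M r c - M r c0 * M r0 c"

lemma sum_elim:
  "(\<Sum>c\<in>C. elim r0 c0 M r c * w c)
    = M r0 c0 * (\<Sum>c\<in>C. M r c * w c) - M r c0 * (\<Sum>c\<in>C. M r0 c * w c)"
  by (simp add: elim_def left_diff_distrib sum_subtractf sum_distrib_left mult.assoc)

lemma triv_kernel_pivot:
  assumes "triv_kernel R (insert c0 C) M" "finite C" "c0 \<notin> C"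
  shows "\<exists>r0\<in>R. M r0 c0 \<noteq> 0"
proof (rule ccontr)
  assume *: "\<not> ?thesis"
  define w :: "'b \<Rightarrow> 'c" where "w c = (if c = c0 then 1 else 0)" for c
  have "(\<Sum>c\<in>insert c0 C. M r c * w c) = 0" if "r \<in> R" for r
  proof (rule sum.neutral, rule ballI)
    fix c assume "c \<in> insert c0 C"
    then show "M r c * w c = 0" using * that by (auto simp: w_def)
  qed
  then have "w c0 = 0" using assms(1) unfolding triv_kernel_def by blast
  then show False by (simp add: w_def)
qed

lemma triv_kernel_elim:
  assumes "r0 \<in> R" "M r0 c0 \<noteq> 0" "finite C" "c0 \<notin> C"
  shows "triv_kernel R (insert c0 C) M \<longleftrightarrow> triv_kernel R C (elim r0 c0 M)"
proof
  assume triv: "triv_kernel R (insert c0 C) M"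
  show "triv_kernel R C (elim r0 c0 M)" unfolding triv_kernel_def
  proof (rule allI, rule impI)
    fix w assume w: "\<forall>r\<in>R. (\<Sum>c\<in>C. elim r0 c0 M r c * w c) = 0"
    \<comment> \<open>Back substitution, scaled by the pivot to avoid division: the entry at
      \<open>c0\<close> is the one forced by row \<open>r0\<close>.\<close>
    define w' where "w' c = (if c = c0 then - (\<Sum>c\<in>C. M r0 c * w c) else M r0 c0 * w c)" for c
    have w'C: "(\<Sum>c\<in>C. M r c * w' c) = M r0 c0 * (\<Sum>c\<in>C. M r c * w c)" for r
      unfolding sum_distrib_left
      by (rule sum.cong) (use assms(4) in \<open>auto simp: w'_def mult_ac\<close>)
    have "(\<Sum>c\<in>insert c0 C. M r c * w' c) = (\<Sum>c\<in>C. elim r0 c0 M r c * w c)" for r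
      using assms(3,4) by (simp add: w'C sum_elim) (simp add: w'_def)
    then have "\<forall>c\<in>insert c0 C. w' c = 0" using triv w unfolding triv_kernel_def by simp
    then show "\<forall>c\<in>C. w c = 0" using assms(2,4) by (auto simp: w'_def split: if_splits)
  qed
next
  assume triv: "triv_kernel R C (elim r0 c0 M)"
  show "triv_kernel R (insert c0 C) M" unfolding triv_kernel_def
  proof (rule allI, rule impI)
    fix w assume w: "\<forall>r\<in>R. (\<Sum>c\<in>insert c0 C. M r c * w c) = 0"
    then have sum: "(\<Sum>c\<in>C. M r c * w c) = - (M r c0 * w c0)" if "r \<in> R" for r
      using assms(3,4) that by (simp add: eq_neg_iff_add_eq_0 add.commute)
    have "(\<Sum>c\<in>C. elim r0 c0 M r c * w c) = 0" if "r \<in> R" for r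
      using that assms(1) by (simp add: sum_elim sum)
    then have 0: "\<forall>c\<in>C. w c = 0" using triv by (simp add: triv_kernel_def)
    then have "M r0 c0 * w c0 = 0" using sum[OF assms(1)] by simp
    then show "\<forall>c\<in>insert c0 C. w c = 0" using 0 assms(2) by simp
  qed
qed

text \<open>\<open>\<Phi>\<close> is the product of the pivots met by the elimination at
  \<open>x0\<close>; wherever it is nonzero, the same elimination goes through. Degrees of the form
  \<open>\<delta> r + \<gamma> c\<close> give both products in \<open>elim\<close> the same
  multidegree, so every pivot is a multiform.\<close>

lemma triv_kernel_open:
  fixes A :: "'r \<Rightarrow> 'c \<Rightarrow> (nat \<times> 3, 'k::field) mpoly"
  assumes "finite C" "\<And>r c. r \<in> R \<Longrightarrow> c \<in> C \<Longrightarrow> multideg n (\<lambda>i. \<delta> r i + \<gamma> c i) (A r c)"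
    and "triv_kernel R C (\<lambda>r c. ev x0 (A r c))"
  shows "\<exists>\<Phi>. is_multiform n \<Phi> \<and> ev x0 \<Phi> \<noteq> 0 \<and>
    (\<forall>x. ev x \<Phi> \<noteq> 0 \<longrightarrow> triv_kernel R C (\<lambda>r c. ev x (A r c)))"
  using assms
proof (induction C arbitrary: A \<delta> rule: finite_induct)
  case empty
  show ?case
    by (intro exI[of _ 1]) (auto simp: is_multiform_one triv_kernel_def)
next
  case (insert c0 C)
  obtain r0 where r0: "r0 \<in> R" "ev x0 (A r0 c0) \<noteq> 0"
    using triv_kernel_pivot[OF insert.prems(2) insert.hyps] by blast
  have elim: "(\<lambda>r c. ev x (elim r0 c0 A r c)) = elim r0 c0 (\<lambda>r c. ev x (A r c))" for x
    by (simp add: elim_def fun_eq_iff eval.hom_diff eval.hom_mult)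
  have "\<exists>\<Phi>. is_multiform n \<Phi> \<and> ev x0 \<Phi> \<noteq> 0 \<and>
    (\<forall>x. ev x \<Phi> \<noteq> 0 \<longrightarrow> triv_kernel R C (\<lambda>r c. ev x (elim r0 c0 A r c)))"
  proof (rule insert.IH[where \<delta> = "\<lambda>r i. \<delta> r0 i + \<gamma> c0 i + \<delta> r i"])
    show "triv_kernel R C (\<lambda>r c. ev x0 (elim r0 c0 A r c))"
      using triv_kernel_elim[OF r0(1) _ insert.hyps, of "\<lambda>r c. ev x0 (A r c)"] r0(2) insert.prems(2)
      by (simp add: elim)
    fix r c assume rc: "r \<in> R" "c \<in> C"
    have "multideg n (\<lambda>i. (\<delta> r0 i + \<gamma> c0 i) + (\<delta> r i + \<gamma> c i)) (A r0 c0 * A r c)"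
      "multideg n (\<lambda>i. (\<delta> r i + \<gamma> c0 i) + (\<delta> r0 i + \<gamma> c i)) (A r c0 * A r0 c)"
      using insert.prems(1) r0 rc by (auto intro!: multideg_mult)
    then show "multideg n (\<lambda>i. \<delta> r0 i + \<gamma> c0 i + \<delta> r i + \<gamma> c i) (elim r0 c0 A r c)"
      unfolding elim_def by (intro multideg_diff) (simp_all add: add_ac)
  qed
  then obtain \<Phi> where \<Phi>: "is_multiform n \<Phi>" "ev x0 \<Phi> \<noteq> 0"
    "\<And>x. ev x \<Phi> \<noteq> 0 \<Longrightarrow> triv_kernel R C (elim r0 c0 (\<lambda>r c. ev x (A r c)))"
    unfolding elim by blast
  have "is_multiform n (A r0 c0)"
    unfolding is_multiform_iff using insert.prems(1)[OF r0(1), of c0] by auto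
  moreover have "triv_kernel R (insert c0 C) (\<lambda>r c. ev x (A r c))"
    if "ev x (A r0 c0) \<noteq> 0" "ev x \<Phi> \<noteq> 0" for x
    using triv_kernel_elim[of r0 R "\<lambda>r c. ev x (A r c)" c0 C] r0(1) insert.hyps \<Phi>(3) that by simp
  ultimately show ?case
    using \<Phi>(1,2) r0(2)
    by (intro exI[of _ "A r0 c0 * \<Phi>"]) (auto simp: is_multiform_mult eval.hom_mult)
qed

text \<open>A trivial kernel means full column rank, so the rows span all vectors indexed by
  \<open>C\<close>. This turns independence of evaluations into the existence of separating
  forms.\<close>

lemma triv_kernel_solve:
  assumes "finite C" "finite R" "triv_kernel R C M"
  shows "\<exists>l. \<forall>c\<in>C. (\<Sum>r\<in>R. l r * M r c) = b c"
  using assms(1,3)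
proof (induction C arbitrary: M b rule: finite_induct)
  case (insert c0 C)
  obtain r0 where r0: "r0 \<in> R" "M r0 c0 \<noteq> 0"
    using triv_kernel_pivot[OF insert.prems insert.hyps] by blast
  let ?p = "M r0 c0"
  have "triv_kernel R C (elim r0 c0 M)"
    using triv_kernel_elim[of r0 R M c0 C] r0 insert.hyps insert.prems by simp
  from insert.IH[OF this, of "\<lambda>c. b c - b c0 * M r0 c / ?p"] obtain l where
    l: "\<And>c. c \<in> C \<Longrightarrow> (\<Sum>r\<in>R. l r * elim r0 c0 M r c) = b c - b c0 * M r0 c / ?p" by blast
  define s where "s = (\<Sum>r\<in>R. l r * M r c0)"
  \<comment> \<open>The coefficient of the pivot row is corrected so that column \<open>c0\<close>
    receives \<open>b c0\<close>; the right-hand side given to the induction hypothesis compensates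
    for this correction in the other columns.\<close>
  define \<mu> where "\<mu> r = ?p * l r + (if r = r0 then b c0 / ?p - s else 0)" for r
  have \<mu>: "(\<Sum>r\<in>R. \<mu> r * M r c) = ?p * (\<Sum>r\<in>R. l r * M r c) + (b c0 / ?p - s) * M r0 c" for c
  proof -
    have "(\<Sum>r\<in>R. \<mu> r * M r c)
        = (\<Sum>r\<in>R. ?p * (l r * M r c) + (if r = r0 then (b c0 / ?p - s) * M r0 c else 0))"
      by (rule sum.cong) (auto simp: \<mu>_def distrib_right mult.assoc)
    also have "\<dots> = ?p * (\<Sum>r\<in>R. l r * M r c) + (b c0 / ?p - s) * M r0 c"
      using assms(2) r0(1) by (simp only: sum.distrib sum.delta sum_distrib_left if_True)
    finally show ?thesis .
  qed
  have el: "(\<Sum>r\<in>R. l r * elim r0 c0 M r c) = ?p * (\<Sum>r\<in>R. l r * M r c) - s * M r0 c" for c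
    by (simp add: elim_def s_def right_diff_distrib sum_subtractf sum_distrib_left sum_distrib_right mult_ac)
  have "(\<Sum>r\<in>R. \<mu> r * M r c) = b c" if "c \<in> insert c0 C" for c
  proof (cases "c = c0")
    case True
    then show ?thesis using r0 by (simp add: \<mu> s_def[symmetric] field_simps)
  next
    case False
    then have "?p * (\<Sum>r\<in>R. l r * M r c) - s * M r0 c = b c - b c0 * M r0 c / ?p"
      using el[of c] l[of c] that by simp
    then have "?p * (\<Sum>r\<in>R. l r * M r c) = b c - b c0 * M r0 c / ?p + s * M r0 c"
      by (simp only: diff_eq_eq)
    then show ?thesis by (simp add: \<mu> algebra_simps)
  qed
  then show ?case by blast
qed auto

text \<open>Along the line joining \<open>x\<close> and \<open>y\<close> both polynomials become
  nonzero univariate ones, whose product has finitely many roots. This replaces the irreducibility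
  of the product of planes.\<close>

lemma common_nonzero:
  fixes \<Phi> \<Psi> :: "(nat \<times> 3, 'k::field) mpoly"
  assumes inf: "infinite (UNIV :: 'k set)" and "ev x \<Phi> \<noteq> 0" "ev y \<Psi> \<noteq> 0"
  shows "\<exists>s. ev (\<lambda>i j. (1 - s) * x i j + s * y i j) \<Phi> \<noteq> 0 \<and> ev (\<lambda>i j. (1 - s) * x i j + s * y i j) \<Psi> \<noteq> 0"
proof -
  let ?z = "\<lambda>s i j. (1 - s) * x i j + s * y i j"
  define P where "P = subst_mpoly (\<lambda>c. [:c:]) (\<lambda>(i, j). [:x i j, y i j - x i j:])"
  have P: "poly (P F) s = ev (?z s) F" for F s
    unfolding P_def subst_comp[OF coeff_hom_poly] eval_mpoly_subst
    by (rule arg_cong2[where f = "\<lambda>h x. subst_mpoly h x F"]; rule ext) (auto simp: algebra_simps)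
  have "poly (P \<Phi>) 0 \<noteq> 0" "poly (P \<Psi>) 1 \<noteq> 0" using assms by (simp_all add: P)
  then have "P \<Phi> * P \<Psi> \<noteq> 0" by auto
  then obtain s where "poly (P \<Phi> * P \<Psi>) s \<noteq> 0"
    using poly_roots_finite ex_new_if_finite[OF inf] by (metis (mono_tags) mem_Collect_eq)
  then show ?thesis by (auto simp: P)
qed

lemma refl_proportional: "v \<noteq> (\<lambda>_. 0) \<Longrightarrow> (v, v) \<in> proportional"
  by (auto simp: proportional_def intro!: exI[of _ 1])

lemma proj_plane_multiple:
  assumes "P \<in> proj_plane" "x \<in> P" "y \<in> P"
  shows "\<exists>c. c \<noteq> 0 \<and> y = (\<lambda>j. c * x j)"
proof -
  obtain u where "P = proportional `` {u}" using assms(1) by (auto simp: proj_plane_def quotient_def)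
  then obtain a b where "x = (\<lambda>i. a * u i)" "y = (\<lambda>i. b * u i)" "a \<noteq> 0" "b \<noteq> 0"
    using assms(2,3) by (auto simp: proportional_def)
  then show ?thesis by (intro exI[of _ "b / a"]) auto
qed

lemma for_generic_pointsI:
  fixes \<Phi> \<Psi> :: "(nat \<times> 3, 'k::field) mpoly"
  assumes inf: "infinite (UNIV :: 'k set)"
    and \<Phi>: "is_multiform n \<Phi>" "ev x \<Phi> \<noteq> 0" and \<Psi>: "is_multiform n \<Psi>" "ev y \<Psi> \<noteq> 0"
    and chart: "\<And>i. x i 2 = 1" "\<And>i. y i 2 = 1"
    and good: "\<And>p z. p \<in> point_tuples n \<Longrightarrow> \<forall>i<n. z i \<in> p i \<and> z i 2 \<noteq> 0 \<Longrightarrow>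
      ev z \<Phi> \<noteq> 0 \<Longrightarrow> ev z \<Psi> \<noteq> 0 \<Longrightarrow> inj_on p {..<n} \<and> Q (p ` {..<n})"
  shows "for_generic_points n Q"
proof -
  \<comment> \<open>The factors \<open>X (i, 2)\<close> keep all points off the line
    \<open>z = 0\<close>.\<close>
  define \<Theta> where "\<Theta> = \<Phi> * \<Psi> * (\<Prod>i<n. X (i, 2))"
  define U where "U = {p \<in> point_tuples n. \<not> multiform_vanishes_at n \<Theta> p}"
  have ev\<Theta>: "ev z \<Theta> \<noteq> 0 \<longleftrightarrow> ev z \<Phi> \<noteq> 0 \<and> ev z \<Psi> \<noteq> 0 \<and> (\<forall>i<n. z i 2 \<noteq> 0)" for z
    by (auto simp: \<Theta>_def eval.hom_mult eval.hom_prod prod_zero_iff)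
  have "is_multiform n \<Theta>"
    unfolding \<Theta>_def by (intro is_multiform_mult is_multiform_prod is_multiform_X \<Phi> \<Psi>) auto
  then have "zariski_open n U"
    unfolding zariski_open_def zariski_closed_def U_def by (intro conjI exI[of _ "{\<Theta>}"]) auto
  moreover have "U \<noteq> {}"
  proof -
    obtain s where s: "ev (\<lambda>i j. (1 - s) * x i j + s * y i j) \<Phi> \<noteq> 0"
      "ev (\<lambda>i j. (1 - s) * x i j + s * y i j) \<Psi> \<noteq> 0"
      using common_nonzero[OF inf \<Phi>(2) \<Psi>(2)] by blast
    define z where "z = (\<lambda>i j. (1 - s) * x i j + s * y i j)"
    define p where "p = (\<lambda>i\<in>{..<n}. proportional `` {z i})"
    \<comment> \<open>Both tuples are normalised to third coordinate 1, and so is every tuple on the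
      line joining them.\<close>
    have z2: "z i 2 = 1" for i by (simp add: z_def chart)
    then have nz: "z i \<noteq> (\<lambda>_. 0)" for i by (metis zero_neq_one)
    have "p \<in> point_tuples n"
      using nz by (auto simp: p_def point_tuples_def proj_plane_def intro!: quotientI)
    moreover have "\<forall>i<n. z i \<in> p i" using refl_proportional[OF nz] by (auto simp: p_def)
    moreover have "ev z \<Theta> \<noteq> 0" using s z2 by (simp add: ev\<Theta> z_def[symmetric])
    ultimately have "p \<in> U" by (auto simp: U_def multiform_vanishes_at_def)
    then show ?thesis by blast
  qed
  moreover have "inj_on p {..<n} \<and> Q (p ` {..<n})" if "p \<in> U" for p
  proof -
    from that obtain z where "\<forall>i<n. z i \<in> p i" "ev z \<Theta> \<noteq> 0"
      by (auto simp: U_def multiform_vanishes_at_def)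
    then show ?thesis using good[of p z] that by (auto simp: ev\<Theta> U_def)
  qed
  ultimately show ?thesis unfolding for_generic_points_def by blast
qed

section \<open>Interpolation and triple points as linear conditions\<close>

definition exponents :: "nat \<Rightarrow> (3 \<Rightarrow>\<^sub>0 nat) set" where
  "exponents d = {m. tdeg m = d}"

lemma finite_exponents: "finite (exponents d)"
proof -
  have "m \<in> (\<lambda>(a, b, c). sg 0 a + sg 1 b + sg 2 c) ` ({..d} \<times> {..d} \<times> {..d})" if "m \<in> exponents d" for m
  proof -
    have "m = sg 0 (lk m 0) + sg 1 (lk m 1) + sg 2 (lk m 2)"
      by (rule poly_mapping_eqI_3) (auto simp: lookup_add lookup_single)
    moreover have "lk m 0 \<le> d" "lk m 1 \<le> d" "lk m 2 \<le> d" using that by (auto simp: exponents_def tdeg_3)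
    ultimately show ?thesis by (intro image_eqI[of _ _ "(lk m 0, lk m 1, lk m 2)"]) auto
  qed
  then have "exponents d \<subseteq> (\<lambda>(a, b, c). sg 0 a + sg 1 b + sg 2 c) ` ({..d} \<times> {..d} \<times> {..d})" by blast
  then show ?thesis by (rule finite_subset) simp
qed

lemma form_exponents: "is_form d F \<Longrightarrow> ks F \<subseteq> exponents d"
  by (auto simp: is_form_iff exponents_def)

definition form_of :: "nat \<Rightarrow> ((3 \<Rightarrow>\<^sub>0 nat) \<Rightarrow> 'k) \<Rightarrow> (3, 'k::comm_ring_1) mpoly" where
  "form_of d w = (\<Sum>m\<in>exponents d. sg m (w m))"

lemma lookup_form_of: "m \<in> exponents d \<Longrightarrow> lk (form_of d w) m = w m"
  by (simp add: form_of_def lookup_sum lookup_single when_def sum.delta finite_exponents)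

lemma is_form_of: "is_form d (form_of d w)"
  unfolding form_of_def by (intro is_form_sum is_form_single) (simp add: exponents_def)

lemma eval_form_exponents:
  "is_form d F \<Longrightarrow> eval_mpoly x F = (\<Sum>m\<in>exponents d. lk F m * mono_val x m)"
  unfolding eval_mpoly_subst
  by (rule coeff_hom.subst_superset[OF coeff_hom_id finite_exponents form_exponents])

definition taylor_mono :: "(3 \<Rightarrow> 'k::comm_ring_1) \<Rightarrow> nat \<Rightarrow> nat \<Rightarrow> (3 \<Rightarrow>\<^sub>0 nat) \<Rightarrow> 'k" where
  "taylor_mono v i j m = of_nat (lk m 0 choose i) * of_nat (lk m 1 choose j) *
     (v 0 ^ (lk m 0 - i) * v 1 ^ (lk m 1 - j) * v 2 ^ lk m 2)"

lemma coeff_taylor_exponents: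
  assumes "is_form d F"
  shows "coeff (coeff (taylor v F) i) j = (\<Sum>m\<in>exponents d. taylor_mono v i j m * lk F m)"
proof -
  have "F = (\<Sum>m\<in>exponents d. sg m (lk F m))"
    by (subst (1) poly_mapping_decomp, rule sum.mono_neutral_left)
      (use form_exponents[OF assms] finite_exponents in \<open>auto simp: in_keys_iff\<close>)
  then have "taylor v F = (\<Sum>m\<in>exponents d. taylor v (sg m (lk F m)))" by (metis taylor.hom_sum)
  then show ?thesis by (simp add: coeff_sum coeff_taylor_single taylor_mono_def mult_ac)
qed

definition interp_entry :: "(3 \<Rightarrow>\<^sub>0 nat) \<Rightarrow> nat \<Rightarrow> (nat \<times> 3, 'k::comm_ring_1) mpoly" where
  "interp_entry m i = sg (sg (i, 0) (lk m 0) + sg (i, 1) (lk m 1) + sg (i, 2) (lk m 2)) 1"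

lemma ev_interp_entry: "ev x (interp_entry m i) = mono_val (x i) m"
  by (simp add: interp_entry_def eval_single mono_val_add mono_val_UNIV[of "x i"] prod_3')

text \<open>A point of the triangular grid is separated from all points that are not above it in both
  coordinates by a product of horizontal and vertical lines.\<close>

lemma triangle_triv_kernel:
  fixes A :: "nat \<Rightarrow> 'k::field" and \<phi> :: "nat \<Rightarrow> nat \<times> nat"
  assumes A: "inj A" and \<phi>: "inj_on \<phi> {..<n}" "\<And>i. i < n \<Longrightarrow> fst (\<phi> i) + snd (\<phi> i) \<le> t"
  shows "triv_kernel (exponents t) {..<n} (\<lambda>m i. mono_val (pt (A (fst (\<phi> i))) (A (snd (\<phi> i)))) m)"
  unfolding triv_kernel_def
proof (rule allI, rule impI)
  fix w
  let ?v = "\<lambda>i. pt (A (fst (\<phi> i))) (A (snd (\<phi> i)))"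
  assume w: "\<forall>m\<in>exponents t. (\<Sum>i<n. mono_val (?v i) m * w i) = 0"
  have ev0: "(\<Sum>i<n. eval_mpoly (?v i) F * w i) = 0" if "is_form t F" for F
  proof -
    have "(\<Sum>i<n. eval_mpoly (?v i) F * w i) = (\<Sum>i<n. \<Sum>m\<in>exponents t. lk F m * (mono_val (?v i) m * w i))"
      by (simp add: eval_form_exponents[OF that] sum_distrib_right mult.assoc)
    also have "\<dots> = (\<Sum>m\<in>exponents t. lk F m * (\<Sum>i<n. mono_val (?v i) m * w i))"
      by (subst sum.swap) (simp add: sum_distrib_left)
    finally show ?thesis using w by simp
  qed
  define h where "h i = fst (\<phi> i) + snd (\<phi> i)" for i
  show "\<forall>i\<in>{..<n}. w i = 0"
  proof (rule ccontr)
    assume "\<not> ?thesis"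
    then obtain k where k: "k < n \<and> w k \<noteq> 0" by auto
    have "\<forall>k. k < n \<and> w k \<noteq> 0 \<longrightarrow> h k < Suc t" using \<phi>(2) by (simp add: h_def less_Suc_eq_le)
    \<comment> \<open>Among the points of nonzero weight one with the largest coordinate sum is
      chosen. Any other such point is smaller in some coordinate, so a factor of \<open>F\<close>
      vanishes there.\<close>
    from ex_has_greatest_nat[of "\<lambda>k. k < n \<and> w k \<noteq> 0", OF k this]
    obtain i where i: "i < n" "w i \<noteq> 0" and max: "\<And>k. k < n \<Longrightarrow> w k \<noteq> 0 \<Longrightarrow> h k \<le> h i"
      by metis
    obtain a b where ab: "\<phi> i = (a, b)" by fastforce
    define F :: "(3, 'k) mpoly" where "F = (\<Prod>c<a. X 0 - scal (A c) * X 2) * (\<Prod>c<b. X 1 - scal (A c) * X 2) * X 2 ^ (t - a - b)"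
    have prod_form: "is_form k (\<Prod>c<k. X l - scal (A c) * X (2 :: 3))" for k l
    proof (induction k)
      case (Suc k)
      have "is_form 1 (X l - scal (A k) * X 2)"
        by (intro is_form_diff is_form_scal_mult is_form_X)
      from is_form_mult[OF Suc this] show ?case by (simp add: mult.commute)
    qed (simp add: is_form_one)
    have "is_form (a + b + (t - a - b)) F"
      unfolding F_def by (intro is_form_mult prod_form is_form_X_power)
    then have F: "is_form t F" using \<phi>(2)[OF i(1)] ab by simp
    have evF: "eval_mpoly (?v k) F
        = (\<Prod>c<a. A (fst (\<phi> k)) - A c) * (\<Prod>c<b. A (snd (\<phi> k)) - A c)" for k
      by (simp add: F_def eval.hom_mult eval.hom_prod eval.hom_diff eval.hom_power)
    have "eval_mpoly (?v k) F * w k = 0" if k: "k < n" "k \<noteq> i" for k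
    proof (rule ccontr)
      assume "eval_mpoly (?v k) F * w k \<noteq> 0"
      then have nz: "w k \<noteq> 0" "\<not> fst (\<phi> k) < a" "\<not> snd (\<phi> k) < b"
        unfolding evF by (auto simp: prod_zero_iff)
      then have "\<phi> k = \<phi> i" using max[OF k(1)] unfolding h_def ab by (auto simp: prod_eq_iff)
      then show False using \<phi>(1) k i by (auto simp: inj_on_def)
    qed
    then have "(\<Sum>k\<in>{..<n} - {i}. eval_mpoly (?v k) F * w k) = 0"
      by (intro sum.neutral) simp
    then have "(\<Sum>k<n. eval_mpoly (?v k) F * w k) = eval_mpoly (?v i) F * w i"
      using i by (subst sum.remove[of _ i]) auto
    moreover have "eval_mpoly (?v i) F \<noteq> 0"
      unfolding evF using A by (auto simp: ab prod_zero_iff inj_eq)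
    ultimately show False using ev0[OF F] i by simp
  qed
qed

lemma interpolation_generic:
  assumes inf: "infinite (UNIV :: 'k::field set)" and n: "2 * n \<le> (t + 1) * (t + 2)"
  shows "\<exists>(\<Phi> :: (nat \<times> 3, 'k) mpoly) x. is_multiform n \<Phi> \<and> ev x \<Phi> \<noteq> 0 \<and> (\<forall>i. x i 2 = 1) \<and>
    (\<forall>z. ev z \<Phi> \<noteq> 0 \<longrightarrow> (\<exists>e. \<forall>i<n. is_form t (e i) \<and>
      (\<forall>j<n. eval_mpoly (z j) (e i) = (if i = j then 1 else 0))))"
proof -
  obtain A :: "nat \<Rightarrow> 'k" where A: "inj A"
    using infinite_countable_subset[OF inf] by auto
  \<comment> \<open>The triangle listed by its diagonals: \<open>s\<close> is the coordinate sum,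
    and \<open>\<phi>\<close> translates a pair back into grid coordinates.\<close>
  define T where "T = (SIGMA s:{..t}. {..s})"
  have "2 * (\<Sum>s\<le>t. Suc s) = (t + 1) * (t + 2)" by (induction t) auto
  then have "card T = (t + 1) * (t + 2) div 2" by (simp add: T_def)
  then have "n \<le> card T" using n by linarith
  then obtain \<psi> where \<psi>: "inj_on \<psi> {..<n}" "\<psi> ` {..<n} \<subseteq> T"
    using card_le_inj[of "{..<n}" T] by (auto simp: T_def)
  define \<phi> where "\<phi> i = (snd (\<psi> i), fst (\<psi> i) - snd (\<psi> i))" for i
  have \<psi>T: "snd (\<psi> i) \<le> fst (\<psi> i)" "fst (\<psi> i) \<le> t" if "i < n" for i
    using \<psi>(2) that by (force simp: T_def)+
  have \<phi>: "inj_on \<phi> {..<n}"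
  proof (rule inj_onI)
    fix i j assume ij: "i \<in> {..<n}" "j \<in> {..<n}" "\<phi> i = \<phi> j"
    then have "\<psi> i = \<psi> j" using \<psi>T[of i] \<psi>T[of j] by (auto simp: \<phi>_def prod_eq_iff)
    then show "i = j" using \<psi>(1) ij by (auto simp: inj_on_def)
  qed
  define x where "x i = pt (A (fst (\<phi> i))) (A (snd (\<phi> i)))" for i
  have "triv_kernel (exponents t) {..<n} (\<lambda>m i. ev x (interp_entry m i))"
    unfolding ev_interp_entry x_def
    by (rule triangle_triv_kernel[OF A \<phi>]) (use \<psi>T in \<open>simp add: \<phi>_def\<close>)
  moreover have "multideg n (\<lambda>k. 0 + (if k = i then t else 0)) (interp_entry m i :: (nat \<times> 3, 'k) mpoly)"
    if m: "m \<in> exponents t" and i: "i \<in> {..<n}" for m i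
  proof -
    have t: "t = lk m 0 + lk m 1 + lk m 2" using m by (simp add: exponents_def tdeg_3)
    show ?thesis unfolding interp_entry_def t add_0_left by (rule multideg_single) (use i in simp)
  qed
  ultimately obtain \<Phi> :: "(nat \<times> 3, 'k) mpoly" where \<Phi>: "is_multiform n \<Phi>" "ev x \<Phi> \<noteq> 0"
    "\<And>z. ev z \<Phi> \<noteq> 0 \<Longrightarrow> triv_kernel (exponents t) {..<n} (\<lambda>m i. mono_val (z i) m)"
    using triv_kernel_open[of "{..<n}" "exponents t" n "\<lambda>_ _. 0" "\<lambda>i k. if k = i then t else 0" interp_entry x]
    unfolding ev_interp_entry by blast
  have "\<exists>e. \<forall>i<n. is_form t (e i) \<and> (\<forall>j<n. eval_mpoly (z j) (e i) = (if i = j then 1 else 0))"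
    if z: "ev z \<Phi> \<noteq> 0" for z
  proof -
    have "\<exists>l. \<forall>j\<in>{..<n}. (\<Sum>m\<in>exponents t. l m * mono_val (z j) m) = (if i = j then 1 else 0)" for i
      using triv_kernel_solve[OF _ finite_exponents \<Phi>(3)[OF z]] by simp
    then obtain l where l: "\<And>i j. j < n \<Longrightarrow> (\<Sum>m\<in>exponents t. l i m * mono_val (z j) m) = (if i = j then 1 else 0)"
      by (metis lessThan_iff)
    have "eval_mpoly (z j) (form_of t (l i)) = (if i = j then 1 else 0)" if "j < n" for i j
      using l[OF that, of i] by (simp add: eval_form_exponents[OF is_form_of] lookup_form_of)
    then show ?thesis by (intro exI[of _ "\<lambda>i. form_of t (l i)"]) (simp add: is_form_of)
  qed
  then show ?thesis using \<Phi> by (intro exI[of _ \<Phi>] exI[of _ x]) (simp add: x_def)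
qed

text \<open>For two points the triple conditions do not suffice to exclude cubics; the additional row
  \<open>None\<close> demands vanishing at the point \<open>(1 : 0 : 0)\<close>.\<close>

definition e0 :: "3 \<Rightarrow> 'k::zero_neq_one" where
  "e0 j = (if j = 0 then 1 else 0)"

definition triple_entry :: "(nat \<times> nat \<times> nat) option \<Rightarrow> (3 \<Rightarrow>\<^sub>0 nat) \<Rightarrow> (nat \<times> 3, 'k::comm_ring_1) mpoly" where
  "triple_entry r m = (case r of None \<Rightarrow> sg 0 (mono_val e0 m)
    | Some (i, a, b) \<Rightarrow> sg (sg (i, 0) (lk m 0 - a) + sg (i, 1) (lk m 1 - b) + sg (i, 2) (lk m 2))
        (of_nat (lk m 0 choose a) * of_nat (lk m 1 choose b)))"

definition triple_rows :: "nat \<Rightarrow> (nat \<times> nat \<times> nat) option set" where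
  "triple_rows n = Some ` {(i, a, b). i < n \<and> a + b < 3} \<union> (if n = 2 then {None} else {})"

definition rigid :: "nat \<Rightarrow> nat \<Rightarrow> (nat \<Rightarrow> 3 \<Rightarrow> 'k::field) \<Rightarrow> bool" where
  "rigid n d z \<longleftrightarrow> (\<forall>F. is_form d F \<longrightarrow> (\<forall>i<n. order_ge 3 (taylor (z i) F)) \<longrightarrow>
     (n = 2 \<longrightarrow> eval_mpoly e0 F = 0) \<longrightarrow> F = 0)"

lemma ev_triple_entry:
  "ev x (triple_entry (Some (i, a, b)) m) = taylor_mono (x i) a b m"
  "ev x (triple_entry None m) = mono_val e0 m"
  by (simp_all add: triple_entry_def eval_single mono_val_add taylor_mono_def)

lemma rigid_iff:
  "rigid n d z \<longleftrightarrow> triv_kernel (triple_rows n) (exponents d) (\<lambda>r m. ev z (triple_entry r m))"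
proof -
  have rows: "(\<forall>r\<in>triple_rows n. (\<Sum>m\<in>exponents d. ev z (triple_entry r m) * lk F m) = 0) \<longleftrightarrow>
    (\<forall>i<n. order_ge 3 (taylor (z i) F)) \<and> (n = 2 \<longrightarrow> eval_mpoly e0 F = 0)" if F: "is_form d F" for F
    by (auto simp: triple_rows_def ev_triple_entry coeff_taylor_exponents[OF F] eval_form_exponents[OF F]
        order_ge_def mult.commute)
  show ?thesis
  proof
    assume rigid: "rigid n d z"
    show "triv_kernel (triple_rows n) (exponents d) (\<lambda>r m. ev z (triple_entry r m))"
      unfolding triv_kernel_def
    proof (rule allI, rule impI)
      fix w assume "\<forall>r\<in>triple_rows n. (\<Sum>m\<in>exponents d. ev z (triple_entry r m) * w m) = 0"
      then have "\<forall>r\<in>triple_rows n. (\<Sum>m\<in>exponents d. ev z (triple_entry r m) * lk (form_of d w) m) = 0"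
        by (simp add: lookup_form_of)
      then have "form_of d w = 0" using rigid is_form_of unfolding rigid_def rows[OF is_form_of] by blast
      then show "\<forall>m\<in>exponents d. w m = 0" by (metis lookup_form_of lookup_zero)
    qed
  next
    assume triv: "triv_kernel (triple_rows n) (exponents d) (\<lambda>r m. ev z (triple_entry r m))"
    show "rigid n d z" unfolding rigid_def
    proof (intro allI impI)
      fix F assume F: "is_form d F" "\<forall>i<n. order_ge 3 (taylor (z i) F)" "n = 2 \<longrightarrow> eval_mpoly e0 F = 0"
      then have "\<forall>m\<in>exponents d. lk F m = 0" using triv rows[OF F(1)] unfolding triv_kernel_def by blast
      then show "F = 0" using form_exponents[OF F(1)]
        by (metis in_keys_iff lookup_zero poly_mapping_eqI subsetD)
    qed
  qed
qed

lemma rigid_open: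
  fixes y :: "nat \<Rightarrow> 3 \<Rightarrow> 'k::field"
  assumes "rigid n d y"
  shows "\<exists>\<Psi>. is_multiform n \<Psi> \<and> ev y \<Psi> \<noteq> 0 \<and> (\<forall>z. ev z \<Psi> \<noteq> 0 \<longrightarrow> rigid n d z)"
proof -
  \<comment> \<open>The Taylor coefficient with index \<open>(a, b)\<close> of any monomial of
    degree \<open>d\<close> has degree \<open>d - a - b\<close> in the coordinates of point
    \<open>i\<close>, so the multidegree depends on the row alone.\<close>
  define \<delta> where "\<delta> r k = (case r of None \<Rightarrow> 0 | Some (i, a, b) \<Rightarrow> if k = i then d - a - b else 0)"
    for r :: "(nat \<times> nat \<times> nat) option" and k :: nat
  have "multideg n (\<lambda>k. \<delta> r k + 0) (triple_entry r m :: (nat \<times> 3, 'k) mpoly)"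
    if r: "r \<in> triple_rows n" and m: "m \<in> exponents d" for r m
  proof (cases r)
    case None
    then show ?thesis by (simp add: triple_entry_def \<delta>_def multideg_const)
  next
    case (Some q)
    obtain i a b where q: "q = (i, a, b)" using prod_cases3 by blast
    have i: "i < n" using r by (auto simp: triple_rows_def Some q split: if_splits)
    show ?thesis
    proof (cases "a \<le> lk m 0 \<and> b \<le> lk m 1")
      case True
      then have eq: "d - a - b = (lk m 0 - a) + (lk m 1 - b) + lk m 2"
        using m by (simp add: exponents_def tdeg_3)
      show ?thesis unfolding triple_entry_def \<delta>_def Some q option.case prod.case eq add_0_right
        by (rule multideg_single[OF i])
    next
      case False
      \<comment> \<open>A binomial coefficient vanishes exactly where truncated subtraction would
        give a wrong degree.\<close>
      then have "triple_entry r m = (0 :: (nat \<times> 3, 'k) mpoly)"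
        by (auto simp: triple_entry_def Some q binomial_eq_0)
      then show ?thesis by (simp add: multideg_def)
    qed
  qed
  from triv_kernel_open[OF finite_exponents this assms[unfolded rigid_iff]] show ?thesis
    unfolding rigid_iff .
qed

lemma rigid_exists:
  assumes inf: "infinite (UNIV :: 'k::field set)" and n: "n \<noteq> 2" "t * (t + 1) div 2 + 1 \<le> n"
  shows "\<exists>y :: nat \<Rightarrow> 3 \<Rightarrow> 'k. rigid n (2 * t + 1) y \<and> (\<forall>i. y i 2 = 1)"
proof -
  obtain S :: "('k \<times> 'k) set" where S: "kills (2 * t + 1) S" "card S \<le> n"
    using kills_exists[OF inf n] by blast
  then have "finite S" "S \<noteq> {}" by (auto simp: kills_def)
  then obtain f and N :: nat where f: "S = f ` {i. i < N}" "card S = N"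
    using finite_imp_nat_seg_image_inj_on[of S] by (metis card_image card_Collect_less_nat)
  \<comment> \<open>Indices from \<open>N\<close> on carry arbitrary points, which only add
    conditions on \<open>F\<close>.\<close>
  define y where "y i = pt (fst (f i)) (snd (f i))" for i
  have "rigid n (2 * t + 1) y" unfolding rigid_def
  proof (intro allI impI)
    fix F assume F: "is_form (2 * t + 1) F" "\<forall>i<n. order_ge 3 (taylor (y i) F)"
    have "order_ge 3 (taylor (pt a b) F)" if ab: "(a, b) \<in> S" for a b
    proof -
      obtain i where "i < N" "f i = (a, b)" using ab f(1) by force
      then show ?thesis using F(2) S(2) f(2) by (auto simp: y_def dest!: spec[of _ i])
    qed
    then show "F = 0" using S(1) F(1) by (auto simp: kills_def)
  qed
  then show ?thesis by (intro exI[of _ y]) (simp add: y_def)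
qed

text \<open>Both points lie on \<open>x = 0\<close>. Their multiplicities split this line off three
  times, which leaves a constant; \<open>(1 : 0 : 0)\<close> is not on the line, so vanishing there
  makes the constant zero.\<close>

lemma rigid_two:
  fixes y :: "nat \<Rightarrow> 3 \<Rightarrow> 'k::field"
  assumes y: "y = (\<lambda>i. pt 0 (if i = 0 then 0 else 1))"
  shows "rigid 2 3 y"
  unfolding rigid_def
proof (intro allI impI)
  fix F :: "(3, 'k) mpoly"
  assume F: "is_form 3 F" "\<forall>i<2. order_ge 3 (taylor (y i) F)" "2 = (2::nat) \<longrightarrow> eval_mpoly e0 F = 0"
  let ?B = "{0, 1 :: 'k}"
  have "y 0 = pt 0 0" "y 1 = pt 0 1" by (simp_all add: y)
  then have order_ge: "order_ge 3 (taylor (pt 0 b) F)" if "b \<in> ?B" for b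
    using F(2)[rule_format, of 0] F(2)[rule_format, of 1] that by auto
  have B: "finite ?B" "card ?B = 2" by auto
  obtain G1 where G1: "F = line 0 * G1" "is_form 2 G1"
    using peel[of 3 F ?B 3 0] F(1) order_ge B by auto
  have l1: "order_ge 2 (taylor (pt 0 b) G1)" if "b \<in> ?B" for b
    using order_ge_line_same[of 3 0 b G1] order_ge[OF that] G1(1) by auto
  obtain G2 where G2: "G1 = line 0 * G2" "is_form 1 G2"
    using peel[of 2 G1 ?B 2 0] G1(2) l1 B by auto
  have l2: "order_ge 1 (taylor (pt 0 b) G2)" if "b \<in> ?B" for b
    using order_ge_line_same[of 2 0 b G2] l1[OF that] G2(1) by auto
  obtain G where G: "G2 = line 0 * G" "is_form 0 G"
    using peel[of 1 G2 ?B 1 0] G2(2) l2 B by auto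
  have "eval_mpoly e0 (line 0 :: (3, 'k) mpoly) = 1"
    by (simp add: line_def eval.hom_diff eval.hom_mult e0_def)
  then have "eval_mpoly e0 G = 0" using F(3) G1 G2 G by (simp add: eval.hom_mult)
  moreover have "m = 0" if "m \<in> ks G" for m
    using G(2) that by (intro poly_mapping_eqI_3) (auto simp: is_form_iff tdeg_3)
  then have "ks G \<subseteq> {0}" by blast
  then have "eval_mpoly e0 G = lk G 0"
    by (simp add: eval_mpoly_subst coeff_hom.subst_superset[OF coeff_hom_id, of "{0}"])
  ultimately have "G = 0" using \<open>ks G \<subseteq> {0}\<close>
    by (metis in_keys_iff lookup_zero poly_mapping_eqI singletonD subsetD)
  then show "F = 0" using G1 G2 G by simp
qed

section \<open>The containment\<close>

text \<open>For two points the determinant is the value at \<open>(1 : 0 : 0)\<close> of the linear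
  form through them; where it is nonzero, a multiple of the cube of that form can absorb the extra
  condition in \<open>rigid\<close>.\<close>

lemma rigid_generic:
  assumes inf: "infinite (UNIV :: 'k::field set)" and t: "t * (t + 1) div 2 + 1 \<le> n"
    and two: "n = 2 \<Longrightarrow> t = 1"
  shows "\<exists>(\<Psi> :: (nat \<times> 3, 'k) mpoly) y. is_multiform n \<Psi> \<and> ev y \<Psi> \<noteq> 0 \<and> (\<forall>i. y i 2 = 1) \<and>
    (\<forall>z. ev z \<Psi> \<noteq> 0 \<longrightarrow> rigid n (2 * t + 1) z \<and> (n = 2 \<longrightarrow> z 0 1 * z 1 2 - z 0 2 * z 1 1 \<noteq> 0))"
proof (cases "n = 2")
  case False
  obtain y :: "nat \<Rightarrow> 3 \<Rightarrow> 'k" where y: "rigid n (2 * t + 1) y" "\<forall>i. y i 2 = 1"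
    using rigid_exists[OF inf False t] by blast
  from rigid_open[OF y(1)] show ?thesis using y(2) False by metis
next
  case True
  define y :: "nat \<Rightarrow> 3 \<Rightarrow> 'k" where "y = (\<lambda>i. pt 0 (if i = 0 then 0 else 1))"
  obtain \<Psi> :: "(nat \<times> 3, 'k) mpoly" where \<Psi>: "is_multiform n \<Psi>" "ev y \<Psi> \<noteq> 0"
    "\<And>z. ev z \<Psi> \<noteq> 0 \<Longrightarrow> rigid n (2 * t + 1) z"
    using rigid_open[OF rigid_two[OF y_def]] two True by auto
  let ?D = "X (0, 1) * X (1, 2) - X (0, 2) * X (1, 1) :: (nat \<times> 3, 'k) mpoly"
  have "is_multiform n ?D"
    unfolding is_multiform_iff
    by (intro exI[of _ "\<lambda>k. (if k = 0 then 1 else 0) + (if k = 1 then 1 else 0)"] multideg_diff multideg_mult multideg_X) (use True in auto)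
  moreover have "ev y ?D \<noteq> 0"
    by (simp add: y_def eval.hom_diff eval.hom_mult)
  ultimately show ?thesis using \<Psi>
    by (intro exI[of _ "\<Psi> * ?D"] exI[of _ y])
      (auto simp: is_multiform_mult eval.hom_mult eval.hom_diff y_def)
qed

lemma vanishes_at_iff:
  assumes "P \<in> proj_plane" "x \<in> P" "is_form d F"
  shows "vanishes_at F P \<longleftrightarrow> eval_mpoly x F = 0"
proof
  assume 0: "eval_mpoly x F = 0"
  show "vanishes_at F P" unfolding vanishes_at_def
  proof
    fix y assume "y \<in> P"
    then obtain c where "y = (\<lambda>j. c * x j)" using proj_plane_multiple[OF assms(1,2)] by blast
    then show "eval_mpoly y F = 0" using 0 by (simp add: eval_form_scale[OF assms(3)])
  qed
qed (use assms(2) in \<open>auto simp: vanishes_at_def\<close>)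

context nodes
begin

text \<open>The condition is imposed on all homogeneous components: elements of the ideals need not
  be forms, and the conclusion is applied to each component separately.\<close>

lemma order_ge_ideal: "is_ideal {F. \<forall>d. order_ge r (taylor w (component d F))}"
  by (auto simp: is_ideal_def component_add taylor.hom_add order_ge_add component_mult taylor.hom_sum
      taylor.hom_mult intro!: order_ge_sum order_ge_mult_left)

lemma order_ge_P: "F \<in> P i \<Longrightarrow> order_ge (Suc 0) (taylor (v i) (component d F))"
proof -
  have "P i \<subseteq> {F. \<forall>d. order_ge (Suc 0) (taylor (v i) (component d F))}"
    unfolding P_def by (rule ideal_gen_least[OF order_ge_ideal]) (auto simp: component_form order_ge_1_iff)
  then show "F \<in> P i \<Longrightarrow> order_ge (Suc 0) (taylor (v i) (component d F))" by blast
qed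

lemma order_ge_P_power: "F \<in> ideal_power (P i) r \<Longrightarrow> order_ge r (taylor (v i) (component d F))"
proof -
  have "ideal_power (P i) r \<subseteq> {F. \<forall>d. order_ge r (taylor (v i) (component d F))}"
  proof (induction r)
    case (Suc r)
    show ?case unfolding ideal_power.simps
    proof (rule ideal_mult_subset[OF order_ge_ideal])
      show "a * b \<in> {F. \<forall>d. order_ge (Suc r) (taylor (v i) (component d F))}"
        if "a \<in> P i" "b \<in> ideal_power (P i) r" for a b
        using order_ge_mult[OF order_ge_P[OF that(1)], of r] that(2) Suc
        by (auto simp: component_mult taylor.hom_sum taylor.hom_mult intro!: order_ge_sum)
    qed
  qed simp
  then show "F \<in> ideal_power (P i) r \<Longrightarrow> order_ge r (taylor (v i) (component d F))" by blast
qed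

text \<open>A power of \<open>z\<close>, which is not a zero divisor, moves \<open>F\<close> to
  degree \<open>2 * t + 1\<close>, where \<open>rigid\<close> applies. For two points, subtracting a
  multiple of the cube of the linear form \<open>L\<close> arranges vanishing at
  \<open>(1 : 0 : 0)\<close>, so the product is that multiple.\<close>

lemma triple_form_in_J_square:
  assumes rigid: "rigid n (2 * t + 1) v" and two: "n = 2 \<Longrightarrow> t = 1"
    and line: "n = 2 \<longrightarrow> v 0 1 * v 1 2 - v 0 2 * v 1 1 \<noteq> 0"
    and F: "is_form d F" "\<And>i. i < n \<Longrightarrow> order_ge 3 (taylor (v i) F)" and d: "d \<le> 2 * t + 1"
  shows "F \<in> ideal_power J 2"
proof -
  define H where "H = X 2 ^ (2 * t + 1 - d) * F"
  have formH: "is_form (2 * t + 1) H"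
    using is_form_mult[OF is_form_X_power F(1), of "2 * t + 1 - d" 2] d by (simp add: H_def)
  have lowH: "order_ge 3 (taylor (v i) H)" if "i < n" for i
    unfolding H_def taylor.hom_mult by (rule order_ge_mult_left) (rule F(2)[OF that])
  have H0: "F = 0" if "H = 0"
  proof -
    have "X 2 ^ k * F = 0 \<Longrightarrow> F = 0" for k
    proof (induction k)
      case (Suc k)
      then have "X 2 * (X 2 ^ k * F) = X 2 * 0" by (simp add: mult.assoc)
      then show ?case using Suc.IH unfolding X_mult_cancel by blast
    qed simp
    then show ?thesis using that unfolding H_def by blast
  qed
  have zero: "0 \<in> ideal_power J 2" using is_ideal_power[of J 2] by (simp add: is_ideal_def)
  show ?thesis
  proof (cases "n = 2")
    case False
    then have "H = 0" using rigid formH lowH unfolding rigid_def by blast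
    then show ?thesis using H0 zero by simp
  next
    case n2: True
    then have t1: "t = 1" using two by simp
    define \<alpha> where "\<alpha> = v 0 1 * v 1 2 - v 0 2 * v 1 1"
    \<comment> \<open>The coefficients form the cross product of \<open>v 0\<close> and
      \<open>v 1\<close>, so \<open>L\<close> defines the line through both points and
      \<open>\<alpha>\<close> is its value at \<open>(1 : 0 : 0)\<close>.\<close>
    define L :: "(3, 'k) mpoly" where "L = scal \<alpha> * X 0
      + scal (v 0 2 * v 1 0 - v 0 0 * v 1 2) * X 1 + scal (v 0 0 * v 1 1 - v 0 1 * v 1 0) * X 2"
    have \<alpha>: "\<alpha> \<noteq> 0" using line n2 by (simp add: \<alpha>_def)
    have "is_form 1 L" unfolding L_def by (intro is_form_add is_form_scal_mult is_form_X)
    moreover have "eval_mpoly (v i) L = 0" if "i < n" for i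
    proof -
      have "i = 0 \<or> i = 1" using that n2 by auto
      then show ?thesis by (auto simp: L_def \<alpha>_def eval.hom_add eval.hom_mult algebra_simps)
    qed
    ultimately have L: "L \<in> I 1" by (simp add: I_def)
    have evL: "eval_mpoly e0 L = \<alpha>" by (simp add: L_def eval.hom_add eval.hom_mult e0_def)
    define c where "c = eval_mpoly e0 H / \<alpha> ^ 3"
    define M where "M = scal c * L * (L * L)"
    have "order_ge 1 (taylor (v i) L)" if "i < n" for i
      using L that by (simp add: order_ge_1_iff I_def)
    then have "order_ge (1 + (1 + 1)) (taylor (v i) M)" if "i < n" for i
      unfolding M_def taylor.hom_mult using that by (intro order_ge_mult order_ge_mult_left)
    then have lowM: "order_ge 3 (taylor (v i) M)" if "i < n" for i
      using that by (simp add: numeral_3_eq_3)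
    have "is_form (1 + (1 + 1)) M"
      unfolding M_def using L by (intro is_form_mult is_form_scal_mult I_form)
    then have "is_form (2 * t + 1) (H - M)" using formH t1
      by (simp add: is_form_diff numeral_3_eq_3)
    moreover have "order_ge 3 (taylor (v i) (H - M))" if "i < n" for i
      using lowH[OF that] lowM[OF that] by (simp add: taylor.hom_diff order_ge_diff)
    moreover have "eval_mpoly e0 (H - M) = 0"
      using \<alpha> by (simp add: M_def eval.hom_diff eval.hom_mult evL c_def power3_eq_cube)
    ultimately have "H - M = 0" using rigid unfolding rigid_def by blast
    then have HM: "H = M" by simp
    show ?thesis
    proof (cases "d = 3")
      case True
      have "H = F" by (simp add: H_def t1 True)
      moreover have "M \<in> ideal_power J 2"
        unfolding M_def using ideal_J I_J[OF L]
        by (intro ideal_power2_memb) (auto simp: is_ideal_def)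
      ultimately show ?thesis using HM by simp
    next
      case False
      \<comment> \<open>In degree below 3 the product \<open>H\<close> contains a factor
        \<open>z\<close>, which is zero at \<open>(1 : 0 : 0)\<close>; hence
        \<open>c = 0\<close>.\<close>
      then obtain k where "2 * t + 1 - d = Suc k" using d t1
        by (metis Suc_diff_Suc le_neq_implies_less mult.right_neutral numeral_2_eq_2 numeral_3_eq_3 Suc_eq_plus1)
      then have "eval_mpoly e0 H = 0"
        by (simp add: H_def eval.hom_mult eval.hom_power e0_def)
      then have "M = 0" by (simp add: M_def c_def scal_def)
      then show ?thesis using H0 HM zero by simp
    qed
  qed
qed

lemma ideal_of_points_J:
  assumes "\<And>i. i < n \<Longrightarrow> p i \<in> proj_plane" "\<And>i. i < n \<Longrightarrow> v i \<in> p i"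
  shows "ideal_of_points (p ` {..<n}) = J"
proof -
  have "{F. (\<exists>d. is_form d F) \<and> (\<forall>q\<in>p ` {..<n}. vanishes_at F q)} = (\<Union>d. I d)"
    using vanishes_at_iff[OF assms] by (auto simp: I_def)
  then show ?thesis by (simp add: ideal_of_points_def J_def)
qed

lemma ideal_of_point_P:
  assumes "p \<in> proj_plane" "v i \<in> p"
  shows "ideal_of_points {p} = P i"
proof -
  have "{F. (\<exists>d. is_form d F) \<and> (\<forall>q\<in>{p}. vanishes_at F q)} =
      {F. (\<exists>d. is_form d F) \<and> eval_mpoly (v i) F = 0}"
    using vanishes_at_iff[OF assms] by auto
  then show ?thesis by (simp add: ideal_of_points_def P_def)
qed

text \<open>The form \<open>e i\<close> is 1 at \<open>v i\<close> and 0 at \<open>v j\<close>,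
  which is impossible at proportional vectors.\<close>

lemma inj_points:
  assumes "\<And>i. i < n \<Longrightarrow> p i \<in> proj_plane" "\<And>i. i < n \<Longrightarrow> v i \<in> p i"
  shows "inj_on p {..<n}"
proof (rule inj_onI, rule ccontr)
  fix i j assume ij: "i \<in> {..<n}" "j \<in> {..<n}" "p i = p j" "i \<noteq> j"
  then obtain c where c: "v i = (\<lambda>l. c * v j l)"
    using proj_plane_multiple[OF assms(1), of j "v j" "v i"] assms(2) by (metis lessThan_iff)
  have "eval_mpoly (v i) (e i) = c ^ t * eval_mpoly (v j) (e i)"
    unfolding c using ij by (intro eval_form_scale form_e) auto
  then show False using ij eval_e by auto
qed

lemma symbolic_cube_in_square:
  assumes "\<And>i. i < n \<Longrightarrow> p i \<in> proj_plane" "\<And>i. i < n \<Longrightarrow> v i \<in> p i"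
    and "rigid n (2 * t + 1) v" "n = 2 \<Longrightarrow> t = 1"
    and "n = 2 \<longrightarrow> v 0 1 * v 1 2 - v 0 2 * v 1 1 \<noteq> 0"
  shows "symbolic_power (p ` {..<n}) 3 \<subseteq> ideal_power (ideal_of_points (p ` {..<n})) 2"
proof
  fix F assume "F \<in> symbolic_power (p ` {..<n}) 3"
  then have F: "F \<in> ideal_power (P i) 3" if "i < n" for i
    using that ideal_of_point_P[OF assms(1,2)] by (auto simp: symbolic_power_def)
  have "F \<in> ideal_power J 2"
  proof (rule sum_components_in_J_square)
    show "F \<in> ideal_power (P i) 2" if "i < n" for i
      using F[OF that] ideal_power_subset[of "P i" 2]
      by (auto simp: P_def is_ideal_gen numeral_3_eq_3 numeral_2_eq_2 simp del: ideal_power.simps)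
    show "component d F \<in> ideal_power J 2" if "d \<le> 2 * t + 1" for d
      by (rule triple_form_in_J_square[OF assms(3) _ assms(5) is_form_component order_ge_P_power[OF F] that])
        (rule assms(4))
  qed
  then show "F \<in> ideal_power (ideal_of_points (p ` {..<n})) 2"
    using ideal_of_points_J[OF assms(1,2)] by simp
qed

end

theorem theorem4p1:
  fixes n :: nat
  assumes "n \<ge> 1"
  shows "for_generic_points n
    (\<lambda>S :: 'k::alg_closed_field point set.
       symbolic_power S 3 \<subseteq> ideal_power (ideal_of_points S) 2)"
proof -
  have inf: "infinite (UNIV :: 'k set)" by (rule infinite_alg_closed)
  define t where "t = (LEAST t. 2 * n \<le> (t + 1) * (t + 2))"
  have "2 * n \<le> (n + 1) * (n + 2)" by simp
  then have t1: "2 * n \<le> (t + 1) * (t + 2)" unfolding t_def by (rule LeastI)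
  \<comment> \<open>Minimality of \<open>t\<close> bounds \<open>n\<close> from below, which
    provides enough triple points for \<open>rigid_generic\<close>.\<close>
  have t2: "t * (t + 1) div 2 + 1 \<le> n"
  proof (cases t)
    case (Suc s)
    then have "\<not> 2 * n \<le> (s + 1) * (s + 2)" unfolding t_def by (intro not_less_Least) simp
    then show ?thesis using Suc by simp
  qed (use assms in simp)
  have two: "t = 1" if "n = 2"
  proof -
    have "t \<le> 1" unfolding t_def by (rule Least_le) (simp add: that)
    moreover have "t \<noteq> 0" using t1 that by (intro notI) simp
    ultimately show ?thesis by simp
  qed
  obtain \<Phi> :: "(nat \<times> 3, 'k) mpoly" and x where \<Phi>: "is_multiform n \<Phi>" "ev x \<Phi> \<noteq> 0" "\<And>i. x i 2 = 1"
    "\<And>z. ev z \<Phi> \<noteq> 0 \<Longrightarrow> \<exists>e. \<forall>i<n. is_form t (e i) \<and>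
      (\<forall>j<n. eval_mpoly (z j) (e i) = (if i = j then 1 else 0))"
    using interpolation_generic[OF inf t1] by metis
  obtain \<Psi> :: "(nat \<times> 3, 'k) mpoly" and y where \<Psi>: "is_multiform n \<Psi>" "ev y \<Psi> \<noteq> 0" "\<And>i. y i 2 = 1"
    "\<And>z. ev z \<Psi> \<noteq> 0 \<Longrightarrow> rigid n (2 * t + 1) z"
    "\<And>z. ev z \<Psi> \<noteq> 0 \<Longrightarrow> n = 2 \<longrightarrow> z 0 1 * z 1 2 - z 0 2 * z 1 1 \<noteq> 0"
    using rigid_generic[OF inf t2 two] by metis
  show ?thesis
  proof (rule for_generic_pointsI[OF inf \<Phi>(1,2) \<Psi>(1,2) \<Phi>(3) \<Psi>(3)])
    fix p z assume p: "p \<in> point_tuples n" and z: "\<forall>i<n. z i \<in> p i \<and> z i 2 \<noteq> 0"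
      and "ev z \<Phi> \<noteq> 0" "ev z \<Psi> \<noteq> 0"
    then obtain e where e: "\<forall>i<n. is_form t (e i) \<and>
      (\<forall>j<n. eval_mpoly (z j) (e i) = (if i = j then 1 else 0))" using \<Phi>(4) by blast
    interpret nodes n t z e by unfold_locales (use z e in auto)
    have "p i \<in> proj_plane" if "i < n" for i using p that by (auto simp: point_tuples_def)
    moreover have "z i \<in> p i" if "i < n" for i using z that by blast
    ultimately show "inj_on p {..<n} \<and>
        symbolic_power (p ` {..<n}) 3 \<subseteq> ideal_power (ideal_of_points (p ` {..<n})) 2"
      using inj_points symbolic_cube_in_square[of p] \<Psi>(4,5)[OF \<open>ev z \<Psi> \<noteq> 0\<close>] two by blast
  qed
qed

end
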